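(* Let $\gamma=\{t\in\mathbb{C}:|t+1|=1\}$, let $\sigma\ge1$, and let $\mu$ be a normal majorant of the class $(\sigma,1)$ such that $\mu(0^+)=0$. Define $g:\gamma\to\mathbb{R}$ by $$g(t)=8\int_0^1\mu(\eta)\,\frac{\big(({\rm Re}\,t)^2-({\rm Im}\,t)^2\big)\big(\eta^4+|t|^4\big)-2\eta^2|t|^4}{\big|\eta^2-t^2\big|^4}\,\eta\,d\eta\qquad\text{for all }t\in\gamma.$$ Then $g$ is continuous on $\gamma$; there is a constant $C$ not depending on $\varepsilon$ such that $$\omega_\gamma(g,\varepsilon)\le C\,\mu(\varepsilon)\qquad\text{for all }\varepsilon\ge0;$$ and there is a constant $c>0$ not depending on $\varepsilon$ such that, for each choice of the sign $\pm$, $$\omega_{\overline{D^{\pm}}}\Big(\big({\rm Re}\,\widetilde{g}\big)^{\pm},\varepsilon\Big)\ge c\,\varepsilon\int_\varepsilon^4\frac{\mu(\eta)}{\eta^2}\,d\eta\qquad\text{for all }\varepsilon\in(0,1/4].$$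
   Context: A normal majorant of the class $(\sigma,k)$ (with constants $\sigma\ge1$, $k\ge0$) is a non-decreasing real-valued function $\mu(\eta)$ of $\eta>0$ satisfying $\mu(\lambda\eta)\le\sigma\lambda^k\mu(\eta)$ for all $\lambda>1$ and all $\eta>0$. Here $\mu(0^+)$ is the right limit at $0$, and we put $\mu(0):=0$ when $\mu(0^+)=0$. The circle $\gamma$ is oriented counterclockwise; $D^+$ is its interior domain and $D^-$ its exterior domain, and the closures $\overline{D^\pm}$ are taken in $\mathbb{C}$. The Cauchy-type integral is $\widetilde g(z):=\frac{1}{2\pi i}\int_\gamma\frac{g(t)}{t-z}\,dt$ for $z\in D^\pm$. It is known that for the circle and any continuous $g:\gamma\to\mathbb{R}$ the function ${\rm Re}\,\widetilde g$ extends continuously from $D^+$ and from $D^-$ to $\gamma$; the continuous extensions of ${\rm Re}\,\widetilde g$ from $D^\pm$ to $\overline{D^\pm}$ are denoted $({\rm Re}\,\widetilde g)^\pm$. For $f:E\to\mathbb{C}$ continuous on $E\subset\mathbb{C}$, the modulus of continuity is $\omega_E(f,\varepsilon):=\sup\{|f(t_1)-f(t_2)|:t_1,t_2\in E,\ |t_1-t_2|\le\varepsilon\}$. *)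

theory Defs
  imports "HOL-Complex_Analysis.Complex_Analysis"
begin

(* A majorant is a function on {0<..}; the values of \<mu> elsewhere are unconstrained. *)
definition normal_majorant :: "real \<Rightarrow> real \<Rightarrow> (real \<Rightarrow> real) \<Rightarrow> bool" where
  "normal_majorant \<sigma> k \<mu> \<longleftrightarrow>
     \<sigma> \<ge> 1 \<and> k \<ge> 0 \<and> mono_on {0<..} \<mu> \<and>
     (\<forall>l>1. \<forall>\<eta>>0. \<mu> (l * \<eta>) \<le> \<sigma> * l powr k * \<mu> \<eta>)"

(* Valued in ereal, since the supremum ranges over a possibly unbounded set E
   and could be infinite. *)
definition modulus_cont ::
    "complex set \<Rightarrow> (complex \<Rightarrow> 'b::real_normed_vector) \<Rightarrow> real \<Rightarrow> ereal" where
  "modulus_cont E f \<epsilon> =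
     Sup {ereal (norm (f t1 - f t2)) |t1 t2. t1 \<in> E \<and> t2 \<in> E \<and> cmod (t1 - t2) \<le> \<epsilon>}"

definition gam :: "complex set" where
  "gam = {t. cmod (t + 1) = 1}"

definition D_plus :: "complex set" where "D_plus = inside gam"
definition D_minus :: "complex set" where "D_minus = outside gam"

(* The path circlepath (-1) 1 traverses gam once, counterclockwise. *)
definition cauchy_type :: "(complex \<Rightarrow> real) \<Rightarrow> complex \<Rightarrow> complex" where
  "cauchy_type g z =
     1 / (2 * complex_of_real pi * \<i>) *
       contour_integral (circlepath (-1) 1) (\<lambda>t. complex_of_real (g t) / (t - z))"

(* The continuous extension of f from D to closure D, whenever there is one
   (see cont_ext_eq below). *)
definition cont_ext :: "complex set \<Rightarrow> (complex \<Rightarrow> real) \<Rightarrow> complex \<Rightarrow> real" where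
  "cont_ext D f z = (if z \<in> D then f z else Lim (at z within D) f)"

lemma cont_ext_eq:
  assumes cont: "continuous_on (closure D) F" and eq: "\<And>z. z \<in> D \<Longrightarrow> F z = f z"
    and z: "z \<in> closure D"
  shows "cont_ext D f z = F z"
proof (cases "z \<in> D")
  case True
  then show ?thesis by (simp add: cont_ext_def eq)
next
  case False
  with z have "z islimpt D" by (simp add: closure_def)
  then have nt: "at z within D \<noteq> bot" by (simp add: trivial_limit_within)
  have "(F \<longlongrightarrow> F z) (at z within closure D)"
    using cont z by (simp add: continuous_on_def)
  then have "(F \<longlongrightarrow> F z) (at z within D)"
    by (rule tendsto_within_subset) (rule closure_subset)
  then have "(f \<longlongrightarrow> F z) (at z within D)"
    by (rule Lim_transform_eventually) (auto simp: eventually_at_filter eq)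
  with nt have "Lim (at z within D) f = F z" by (rule tendsto_Lim)
  with False show ?thesis by (simp add: cont_ext_def)
qed

lemma gam_eq_sphere: "gam = sphere (-1) 1"
  by (auto simp: gam_def dist_norm norm_minus_commute add.commute)

lemma gam_eq_path_image: "gam = path_image (circlepath (-1) 1)"
  by (simp add: gam_eq_sphere)

lemma D_plus_eq: "D_plus = ball (-1) 1"
  using inside_frontier_eq_interior[of "cball (-1::complex) 1"]
  by (simp add: D_plus_def gam_eq_sphere)

lemma D_minus_eq: "D_minus = - cball (-1) 1"
  using outside_frontier_eq_complement_closure[of "cball (-1::complex) 1"]
  by (simp add: D_minus_def gam_eq_sphere)

end

theory Submission
  imports Defs
begin

text \<open>
  The density is \<open>\<integral> \<mu>(\<eta>) k(\<eta>, t) d\<eta>\<close> with \<open>k(\<eta>, t) = 8 \<eta> Re (t\<^sup>2 / (\<eta>\<^sup>2 - t\<^sup>2)\<^sup>2)\<close>. On the circle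
  \<open>\<bar>\<eta>\<^sup>2 - t\<^sup>2\<bar>\<close> is comparable to \<open>\<eta>\<^sup>2 + \<bar>t\<bar>\<^sup>2\<close>, so \<open>k\<close> and its increments in \<open>t\<close> have elementary bounds;
  together with \<open>\<mu>(\<eta>) \<le> \<mu>(r) (1 + \<sigma> \<eta> / r)\<close> they give the upper estimate.

  For the lower estimate, \<open>k(\<eta>, \<cdot>)\<close> agrees on the circle with the real part of a rational function
  holomorphic inside, so by Cauchy's formula and Fubini, for \<open>0 < x < 1\<close>, the real part of the
  Cauchy-type integral at \<open>-x\<close> is a constant minus \<open>U(x) + U(x / (1 - x))\<close>, where
  \<open>U(x) = \<integral> \<mu>(\<eta>) x / (x + \<eta>)\<^sup>2 d\<eta>\<close> over \<open>[0, 1]\<close>. Inversion in the circle gives a constant plus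
  \<open>U(x) + U(x / (1 + x))\<close> at the exterior point \<open>x\<close>. Since \<open>U(x) \<longlongrightarrow> 0\<close> as \<open>x \<longlongrightarrow> 0\<close>, both moduli of
  continuity at \<open>\<epsilon>\<close> are at least \<open>U(\<epsilon>)\<close>, which dominates the integral in the statement.
\<close>

section \<open>The kernel on the circle: explicit form and bounds\<close>

definition kern :: "real \<Rightarrow> complex \<Rightarrow> real" where
  "kern \<eta> t = 8 * \<eta> * Re (t\<^sup>2 / ((complex_of_real \<eta>)\<^sup>2 - t\<^sup>2)\<^sup>2)"

text \<open>Expanding \<open>t\<^sup>2 / (\<eta>\<^sup>2 - t\<^sup>2)\<^sup>2\<close> by the
  conjugate of its denominator turns the denominator into the fourth power of a modulus; the
  numerator then has as real part the polynomial that occurs in the given density.\<close>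

lemma kern_eq:
  "((Re t)\<^sup>2 - (Im t)\<^sup>2) * (\<eta> ^ 4 + cmod t ^ 4) - 2 * \<eta>\<^sup>2 * cmod t ^ 4
      = Re (t\<^sup>2 * cnj (((complex_of_real \<eta>)\<^sup>2 - t\<^sup>2)\<^sup>2))"
proof -
  have t4: "cmod t ^ 4 = ((Re t)\<^sup>2 + (Im t)\<^sup>2)\<^sup>2"
    by (metis cmod_power2 numeral_Bit0 power_add power2_eq_square)
  show ?thesis
    unfolding t4 by (cases t) (simp add: power2_eq_square algebra_simps power4_eq_xxxx)
qed

lemma kern_explicit:
  "8 * (((((Re t)\<^sup>2 - (Im t)\<^sup>2) * (\<eta> ^ 4 + cmod t ^ 4) - 2 * \<eta>\<^sup>2 * cmod t ^ 4)
      / cmod ((complex_of_real \<eta>)\<^sup>2 - t\<^sup>2) ^ 4) * \<eta>) = kern \<eta> t"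
proof -
  define d where "d = ((complex_of_real \<eta>)\<^sup>2 - t\<^sup>2)\<^sup>2"
  have "cmod ((complex_of_real \<eta>)\<^sup>2 - t\<^sup>2) ^ 4 = (cmod d)\<^sup>2"
    by (simp add: d_def norm_power)
  moreover have "Re (t\<^sup>2 / d) = Re (t\<^sup>2 * cnj d) / (cmod d)\<^sup>2"
    by (metis Re_divide_of_real complex_div_cnj)
  ultimately show ?thesis
    unfolding kern_eq kern_def d_def [symmetric] by simp
qed

lemma kern_0 [simp]: "kern \<eta> 0 = 0"
  by (simp add: kern_def)

text \<open>Square \<open>cmod (t + 1) = 1\<close>. The circle touches the imaginary axis at 0, so
  \<open>Re t\<close> is quadratically small there; this keeps \<open>t\<close> away from the real
  points \<eta> and -\<eta>.\<close>

lemma gam_Re: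
  assumes "t \<in> gam" shows "2 * Re t = - (cmod t)\<^sup>2"
proof -
  have "(cmod (t + 1))\<^sup>2 = 1"
    using assms by (simp add: gam_def)
  then show ?thesis
    unfolding cmod_power2 by (simp add: power2_eq_square algebra_simps)
qed

lemma gam_norm_le: "t \<in> gam \<Longrightarrow> cmod t \<le> 2"
  using norm_triangle_ineq4[of "t + 1" 1] by (simp add: gam_def)

text \<open>The denominator factors into \<open>\<eta> - t\<close> and \<open>\<eta> + t\<close>. By
  \<open>gam_Re\<close> the squared modulus of each factor is an explicit expression in \<eta> and
  \<open>r\<close>, affine in \<open>r\<close>, so each can be compared with
  \<open>\<eta>\<^sup>2 + r\<close> separately.\<close>

lemma gam_denominator:
  assumes t: "t \<in> gam" and \<eta>: "0 \<le> \<eta>" "\<eta> \<le> 1"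
  shows "(\<eta>\<^sup>2 + (cmod t)\<^sup>2)\<^sup>2 \<le> 5 * (cmod ((complex_of_real \<eta>)\<^sup>2 - t\<^sup>2))\<^sup>2"
proof -
  define r where "r = (cmod t)\<^sup>2"
  have r: "0 \<le> r" "r \<le> 4"
    using gam_norm_le[OF t] power_mono[of "cmod t" 2 2] by (auto simp: r_def)
  have Re: "Re t = - r / 2" using gam_Re[OF t] by (simp add: r_def)
  have m: "(cmod (\<eta> - t))\<^sup>2 = \<eta>\<^sup>2 + (1 + \<eta>) * r"
  proof -
    have "(cmod (\<eta> - t))\<^sup>2 = \<eta>\<^sup>2 - 2 * \<eta> * Re t + r"
      unfolding r_def cmod_power2 by (simp add: power2_eq_square algebra_simps)
    then show ?thesis by (simp add: Re algebra_simps)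
  qed
  have p: "(cmod (\<eta> + t))\<^sup>2 = \<eta>\<^sup>2 + (1 - \<eta>) * r"
  proof -
    have "(cmod (\<eta> + t))\<^sup>2 = \<eta>\<^sup>2 + 2 * \<eta> * Re t + r"
      unfolding r_def cmod_power2 by (simp add: power2_eq_square algebra_simps)
    then show ?thesis by (simp add: Re algebra_simps)
  qed
  have "\<eta>\<^sup>2 + r \<le> \<eta>\<^sup>2 + (1 + \<eta>) * r"
    using r \<eta> by (simp add: algebra_simps)
  \<comment> \<open>The difference of the two sides is
    \<open>4 * \<eta>\<^sup>2 + (4 - 5 * \<eta>) * r\<close>, affine in \<open>r\<close> on [0, 4].
    If the slope is negative, its least value is the one at \<open>r = 4\<close>, namely
    \<open>4 * (1 - \<eta>) * (4 - \<eta>)\<close>. Equality at \<eta> = 1, \<open>r = 4\<close>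
    shows where the 5 comes from.\<close>
  moreover have "\<eta>\<^sup>2 + r \<le> 5 * (\<eta>\<^sup>2 + (1 - \<eta>) * r)"
  proof (cases "5 * \<eta> \<le> 4")
    case True
    then have "1 * r \<le> (5 - 5 * \<eta>) * r" using r by (intro mult_right_mono) auto
    moreover have "0 \<le> 4 * \<eta>\<^sup>2" by simp
    ultimately show ?thesis by (simp only: algebra_simps)
  next
    case False
    have "(5 * \<eta> - 4) * r \<le> (5 * \<eta> - 4) * 4" using r False by (intro mult_left_mono) auto
    moreover have "0 \<le> (1 - \<eta>) * (4 - \<eta>)" using \<eta> by (intro mult_nonneg_nonneg) auto
    ultimately show ?thesis by (simp add: power2_eq_square algebra_simps)
  qed
  ultimately have "(\<eta>\<^sup>2 + r) * (\<eta>\<^sup>2 + r) \<le> (cmod (\<eta> - t))\<^sup>2 * (5 * (cmod (\<eta> + t))\<^sup>2)"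
    unfolding m p by (intro mult_mono) (use r \<eta> in auto)
  also have "\<dots> = 5 * (cmod ((\<eta> - t) * (\<eta> + t)))\<^sup>2"
    by (simp add: norm_mult power_mult_distrib)
  also have "(\<eta> - t) * (\<eta> + t) = (complex_of_real \<eta>)\<^sup>2 - t\<^sup>2"
    by (simp add: power2_eq_square algebra_simps)
  finally show ?thesis by (simp add: r_def power2_eq_square)
qed

lemma kern_bound:
  assumes t: "t \<in> gam" and \<eta>: "0 \<le> \<eta>" "\<eta> \<le> 1"
  shows "\<bar>kern \<eta> t\<bar> \<le> 40 * (\<eta> * (cmod t)\<^sup>2 / (\<eta>\<^sup>2 + (cmod t)\<^sup>2)\<^sup>2)"
proof (cases "t = 0")
  case False
  define d where "d = (complex_of_real \<eta>)\<^sup>2 - t\<^sup>2"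
  have pos: "(\<eta>\<^sup>2 + (cmod t)\<^sup>2)\<^sup>2 > 0"
    using False by (simp add: add_nonneg_pos)
  have le: "(\<eta>\<^sup>2 + (cmod t)\<^sup>2)\<^sup>2 \<le> 5 * (cmod d)\<^sup>2"
    unfolding d_def by (rule gam_denominator [OF t \<eta>])
  have "\<bar>Re (t\<^sup>2 / d\<^sup>2)\<bar> \<le> (cmod t)\<^sup>2 / (cmod d)\<^sup>2"
    using abs_Re_le_cmod[of "t\<^sup>2 / d\<^sup>2"] by (simp add: norm_divide norm_power)
  also have "\<dots> \<le> (cmod t)\<^sup>2 / ((\<eta>\<^sup>2 + (cmod t)\<^sup>2)\<^sup>2 / 5)"
    using pos le by (intro divide_left_mono) (auto intro!: mult_pos_pos)
  also have "\<dots> = 5 * ((cmod t)\<^sup>2 / (\<eta>\<^sup>2 + (cmod t)\<^sup>2)\<^sup>2)" by simp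
  finally have "\<bar>Re (t\<^sup>2 / d\<^sup>2)\<bar> \<le> 5 * ((cmod t)\<^sup>2 / (\<eta>\<^sup>2 + (cmod t)\<^sup>2)\<^sup>2)" .
  then have "8 * \<eta> * \<bar>Re (t\<^sup>2 / d\<^sup>2)\<bar> \<le> 8 * \<eta> * (5 * ((cmod t)\<^sup>2 / (\<eta>\<^sup>2 + (cmod t)\<^sup>2)\<^sup>2))"
    using \<eta> by (intro mult_left_mono) auto
  also have "\<dots> = 40 * (\<eta> * (cmod t)\<^sup>2 / (\<eta>\<^sup>2 + (cmod t)\<^sup>2)\<^sup>2)" by simp
  finally show ?thesis
    using \<eta> by (simp add: kern_def d_def abs_mult)
qed auto

text \<open>Over a common denominator the numerator factors as \<open>(t1 - t2) * (t1 + t2) *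
  (\<eta> ^ 4 - t1\<^sup>2 * t2\<^sup>2)\<close>. The last factor is at most the product of the two
  sums \<open>\<eta>\<^sup>2 + (cmod t)\<^sup>2\<close>, which cancels one power of each in the
  denominator. The constant is 8 times 5 times 5, from two uses of
  \<open>gam_denominator\<close>.\<close>

lemma kern_diff_bound:
  assumes t: "t1 \<in> gam" "t2 \<in> gam" and nz: "t1 \<noteq> 0" "t2 \<noteq> 0" and \<eta>: "0 \<le> \<eta>" "\<eta> \<le> 1"
  shows "\<bar>kern \<eta> t1 - kern \<eta> t2\<bar> \<le> 200 * (\<eta> * (cmod (t1 - t2) * (cmod t1 + cmod t2))
           / ((\<eta>\<^sup>2 + (cmod t1)\<^sup>2) * (\<eta>\<^sup>2 + (cmod t2)\<^sup>2)))"
proof -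
  define d where "d t = (complex_of_real \<eta>)\<^sup>2 - t\<^sup>2" for t
  define q where "q t = \<eta>\<^sup>2 + (cmod t)\<^sup>2" for t
  have q: "q t1 > 0" "q t2 > 0" using nz by (auto simp: q_def add_nonneg_pos)
  have le: "(q t1)\<^sup>2 \<le> 5 * (cmod (d t1))\<^sup>2" "(q t2)\<^sup>2 \<le> 5 * (cmod (d t2))\<^sup>2"
    unfolding d_def q_def using gam_denominator t \<eta> by auto
  have dnz: "d t1 \<noteq> 0" "d t2 \<noteq> 0" using le q by fastforce+
  have "t1\<^sup>2 / (d t1)\<^sup>2 - t2\<^sup>2 / (d t2)\<^sup>2
      = (t1\<^sup>2 * (d t2)\<^sup>2 - t2\<^sup>2 * (d t1)\<^sup>2) / ((d t1)\<^sup>2 * (d t2)\<^sup>2)"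
    using dnz by (simp add: field_simps)
  also have "t1\<^sup>2 * (d t2)\<^sup>2 - t2\<^sup>2 * (d t1)\<^sup>2
     = (t1 - t2) * (t1 + t2) * ((complex_of_real \<eta>) ^ 4 - t1\<^sup>2 * t2\<^sup>2)"
    unfolding d_def by algebra
  finally have eq: "t1\<^sup>2 / (d t1)\<^sup>2 - t2\<^sup>2 / (d t2)\<^sup>2 =
     (t1 - t2) * (t1 + t2) * ((complex_of_real \<eta>) ^ 4 - t1\<^sup>2 * t2\<^sup>2) / ((d t1)\<^sup>2 * (d t2)\<^sup>2)" .
  define N where "N = cmod (t1 - t2) * (cmod t1 + cmod t2)"
  have N0: "0 \<le> N" by (simp add: N_def)
  have "cmod ((complex_of_real \<eta>) ^ 4 - t1\<^sup>2 * t2\<^sup>2) \<le> \<eta> ^ 4 + (cmod t1)\<^sup>2 * (cmod t2)\<^sup>2"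
    using norm_triangle_ineq4[of "(complex_of_real \<eta>) ^ 4" "t1\<^sup>2 * t2\<^sup>2"] \<eta>
    by (simp add: norm_mult norm_power)
  also have "\<dots> \<le> q t1 * q t2"
  proof -
    have "q t1 * q t2 = \<eta> ^ 4 + (cmod t1)\<^sup>2 * (cmod t2)\<^sup>2 + \<eta>\<^sup>2 * ((cmod t1)\<^sup>2 + (cmod t2)\<^sup>2)"
      unfolding q_def by algebra
    then show ?thesis by simp
  qed
  finally have n4: "cmod ((complex_of_real \<eta>) ^ 4 - t1\<^sup>2 * t2\<^sup>2) \<le> q t1 * q t2" .
  have "\<bar>Re (t1\<^sup>2 / (d t1)\<^sup>2 - t2\<^sup>2 / (d t2)\<^sup>2)\<bar> \<le> cmod (t1\<^sup>2 / (d t1)\<^sup>2 - t2\<^sup>2 / (d t2)\<^sup>2)"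
    by (rule abs_Re_le_cmod)
  also have "\<dots> = cmod (t1 - t2) * cmod (t1 + t2) * cmod ((complex_of_real \<eta>) ^ 4 - t1\<^sup>2 * t2\<^sup>2)
        / ((cmod (d t1))\<^sup>2 * (cmod (d t2))\<^sup>2)"
    unfolding eq by (simp add: norm_mult norm_divide norm_power)
  also have "\<dots> \<le> N * (q t1 * q t2) / (((q t1)\<^sup>2 / 5) * ((q t2)\<^sup>2 / 5))"
    unfolding N_def using le q n4
    by (intro frac_le mult_mono mult_pos_pos) (auto simp: norm_triangle_ineq)
  also have "\<dots> = 25 * (N / (q t1 * q t2))"
    using q by (simp add: field_simps power2_eq_square)
  finally have "8 * \<eta> * \<bar>Re (t1\<^sup>2 / (d t1)\<^sup>2 - t2\<^sup>2 / (d t2)\<^sup>2)\<bar> \<le> 8 * \<eta> * (25 * (N / (q t1 * q t2)))"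
    using \<eta> by (intro mult_left_mono) auto
  moreover have "\<bar>kern \<eta> t1 - kern \<eta> t2\<bar> = 8 * \<eta> * \<bar>Re (t1\<^sup>2 / (d t1)\<^sup>2 - t2\<^sup>2 / (d t2)\<^sup>2)\<bar>"
    using \<eta> unfolding kern_def d_def minus_complex.sel right_diff_distrib[symmetric] by (simp add: abs_mult)
  ultimately show ?thesis by (simp add: N_def q_def mult_ac)
qed

section \<open>A representative of the kernel holomorphic inside the circle\<close>

text \<open>Partial fractions split \<open>8 * \<eta> * t\<^sup>2 / (\<eta>\<^sup>2 -
  t\<^sup>2)\<^sup>2\<close> into double-pole terms at \<eta>, outside the disc, and at -\<eta>,
  inside. The first term is kept. The second one is traded for its conjugate on the circle, whose
  pole is the reflected point \<open>\<eta> / (1 - \<eta>)\<close> (no finite pole if \<eta> =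
  1).\<close>

definition holo_kern :: "real \<Rightarrow> complex \<Rightarrow> complex" where
  "holo_kern \<eta> t = 2 * t / (t - \<eta>)\<^sup>2 + 2 * t * (1 + t) / (\<eta> - (1 - \<eta>) * t)\<^sup>2"

text \<open>On the closed disc \<open>Re t \<le> 0\<close>, so the real parts of
  \<open>t - \<eta>\<close> and of \<open>\<eta> - (1 - \<eta>) * t\<close> are strictly negative
  and strictly positive.\<close>

lemma holo_kern_holomorphic:
  assumes "0 < \<eta>" "\<eta> \<le> 1"
  shows "holo_kern \<eta> holomorphic_on cball (-1) 1"
proof -
  have "t - \<eta> \<noteq> 0 \<and> \<eta> - (1 - \<eta>) * t \<noteq> 0" if "t \<in> cball (-1) 1" for t :: complex
  proof -
    have "\<bar>Re (t + 1)\<bar> \<le> 1"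
      using that abs_Re_le_cmod[of "t + 1"] by (simp add: dist_norm norm_minus_commute add.commute)
    then have le: "Re t \<le> 0" by simp
    then have "Re (t - \<eta>) < 0" "(1 - \<eta>) * Re t \<le> 0"
      using assms by (auto intro: mult_nonneg_nonpos)
    then have "Re (t - \<eta>) < 0" "Re (\<eta> - (1 - \<eta>) * t) > 0"
      using assms by auto
    then show ?thesis by (metis less_irrefl zero_complex.sel(1))
  qed
  then show ?thesis
    unfolding holo_kern_def by (intro holomorphic_intros) auto
qed

text \<open>The part of the kernel that is singular inside the circle is replaced by its
  complex conjugate, which is holomorphic inside because \<open>cnj t = - t / (1 + t)\<close> on \<open>gam\<close>.\<close>

lemma kern_eq_Re_holo_kern:
  assumes t: "t \<in> gam" and \<eta>: "0 < \<eta>" "\<eta> \<le> 1"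
  shows "kern \<eta> t = Re (holo_kern \<eta> t)"
proof -
  have "cmod (1 + t) = 1" using t by (simp add: gam_def add.commute)
  then have nz: "1 + t \<noteq> 0" and "(1 + t) * (1 + cnj t) = 1"
    using complex_norm_square[of "1+t"] by auto
  then have "cnj t * (1 + t) = - t"
    by algebra
  then have ct: "cnj t = - t / (1 + t)"
    using nz by (metis nonzero_eq_divide_eq)
  have "0 < (\<eta>\<^sup>2 + (cmod t)\<^sup>2)\<^sup>2" using \<eta> by (simp add: add_pos_nonneg)
  then have "(complex_of_real \<eta>)\<^sup>2 - t\<^sup>2 \<noteq> 0"
    using gam_denominator[OF t, of \<eta>] \<eta> by fastforce
  then have "(\<eta> - t) * (\<eta> + t) \<noteq> 0" by (simp add: power2_eq_square algebra_simps)
  then have m: "\<eta> - t \<noteq> 0" and p: "\<eta> + t \<noteq> 0" by auto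
  have "8 * complex_of_real \<eta> * (t\<^sup>2 / ((complex_of_real \<eta>)\<^sup>2 - t\<^sup>2)\<^sup>2)
      = 8 * \<eta> * t\<^sup>2 / ((\<eta> - t)\<^sup>2 * (\<eta> + t)\<^sup>2)"
    by (simp add: power2_eq_square algebra_simps)
  also have "\<dots> = 2 * t / (\<eta> - t)\<^sup>2 - 2 * t / (\<eta> + t)\<^sup>2"
    using m p by (simp add: divide_simps) (simp add: power2_eq_square algebra_simps)
  finally have a: "8 * complex_of_real \<eta> * (t\<^sup>2 / ((complex_of_real \<eta>)\<^sup>2 - t\<^sup>2)\<^sup>2)
     = 2 * t / (\<eta> - t)\<^sup>2 - 2 * t / (\<eta> + t)\<^sup>2" .
  have "kern \<eta> t = Re (8 * complex_of_real \<eta> * (t\<^sup>2 / ((complex_of_real \<eta>)\<^sup>2 - t\<^sup>2)\<^sup>2))"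
    by (simp add: kern_def mult.assoc del: times_divide_eq_right)
  also have "\<dots> = Re (2 * t / (\<eta> - t)\<^sup>2) - Re (cnj (2 * t / (\<eta> + t)\<^sup>2))"
    unfolding a by (simp only: minus_complex.sel cnj.sel)
  also have "cnj (2 * t / (\<eta> + t)\<^sup>2) = 2 * cnj t / (\<eta> + cnj t)\<^sup>2" by simp
  also have "\<dots> = - (2 * t * (1 + t) / (\<eta> - (1 - \<eta>) * t)\<^sup>2)"
  proof -
    have "\<eta> + cnj t = (\<eta> - (1 - \<eta>) * t) / (1 + t)"
      unfolding ct using nz by (simp add: field_simps)
    then show ?thesis
      unfolding ct using nz by (simp add: power2_eq_square divide_simps)
  qed
  finally show ?thesis by (simp add: holo_kern_def power2_commute)
qed

text \<open>On the real axis both summands are real; for 0 < x < 1 the second one is the first with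
  \<open>x / (1 - x)\<close> in place of \<open>x\<close>.\<close>

lemma holo_kern_real:
  "holo_kern \<eta> (- of_real x) =
     of_real (- 2 * (x / (x + \<eta>)\<^sup>2 + x * (1 - x) / (\<eta> + (1 - \<eta>) * x)\<^sup>2))"
proof -
  have "(- complex_of_real x - \<eta>)\<^sup>2 = (complex_of_real x + \<eta>)\<^sup>2"
    by (simp add: power2_eq_square algebra_simps)
  then show ?thesis
    by (simp add: holo_kern_def algebra_simps)
qed

section \<open>Elementary integrals and integration against a majorant\<close>

text \<open>A crude bound for fixed \<open>r\<close>; it serves integrability only, not the size
  estimates.\<close>

lemma kern_majorant_le:
  fixes r \<eta> :: real
  assumes r: "0 < r" and \<eta>: "0 \<le> \<eta>" "\<eta> \<le> 1"
  shows "\<eta> * r\<^sup>2 / (\<eta>\<^sup>2 + r\<^sup>2)\<^sup>2 \<le> 1 / r\<^sup>2"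
proof -
  have "\<eta> * r\<^sup>2 / (\<eta>\<^sup>2 + r\<^sup>2)\<^sup>2 \<le> 1 * r\<^sup>2 / (r\<^sup>2)\<^sup>2"
    using assms by (intro frac_le mult_mono power_mono) auto
  then show ?thesis using r by (simp add: power2_eq_square)
qed

lemma measurable_kern [measurable]: "(\<lambda>\<eta>. kern \<eta> t) \<in> borel_measurable borel"
  unfolding kern_def by measurable

lemma pot_kern_le:
  fixes x \<eta> :: real
  assumes "0 < x" "0 \<le> \<eta>" shows "\<bar>x / (x + \<eta>)\<^sup>2\<bar> \<le> 1 / x"
proof -
  have "x / (x + \<eta>)\<^sup>2 \<le> x / x\<^sup>2"
    using assms by (intro divide_left_mono power_mono) auto
  then show ?thesis using assms by (simp add: power2_eq_square)
qed

lemma pot_kern_integral: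
  fixes x :: real
  assumes "0 < x"
  shows "((\<lambda>\<eta>. x / (x + \<eta>)\<^sup>2) has_integral 1 - x / (x + 1)) {0..1}"
proof -
  have "((\<lambda>\<eta>. x / (x + \<eta>)\<^sup>2) has_integral (- x / (x + 1)) - (- x / (x + 0))) {0..1}"
  proof (rule fundamental_theorem_of_calculus)
    fix \<eta> :: real assume "\<eta> \<in> {0..1}"
    then have "((\<lambda>\<eta>. - x / (x + \<eta>)) has_real_derivative x / (x + \<eta>)\<^sup>2) (at \<eta> within {0..1})"
      using assms by (auto intro!: derivative_eq_intros simp: power2_eq_square)
    then show "((\<lambda>\<eta>. - x / (x + \<eta>)) has_vector_derivative x / (x + \<eta>)\<^sup>2) (at \<eta> within {0..1})"
      by (simp add: has_real_derivative_iff_has_vector_derivative)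
  qed simp
  then show ?thesis using assms by simp
qed

lemma inverse_sq_integral:
  fixes a b :: real
  assumes "0 < a" "a \<le> b"
  shows "((\<lambda>\<eta>. 1 / \<eta>\<^sup>2) has_integral 1 / a - 1 / b) {a..b}"
proof -
  have "((\<lambda>\<eta>. 1 / \<eta>\<^sup>2) has_integral (- 1 / b) - (- 1 / a)) {a..b}"
  proof (rule fundamental_theorem_of_calculus)
    fix \<eta> :: real assume "\<eta> \<in> {a..b}"
    then have "((\<lambda>\<eta>. - 1 / \<eta>) has_real_derivative 1 / \<eta>\<^sup>2) (at \<eta> within {a..b})"
      using assms by (auto intro!: derivative_eq_intros simp: power2_eq_square)
    then show "((\<lambda>\<eta>. - 1 / \<eta>) has_vector_derivative 1 / \<eta>\<^sup>2) (at \<eta> within {a..b})"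
      by (simp add: has_real_derivative_iff_has_vector_derivative)
  qed fact
  then show ?thesis by simp
qed

text \<open>The majorant is taken on the whole line, with value 0 on the nonpositive half-line. This
  makes it globally monotone, hence Borel measurable, and nonnegative everywhere.\<close>

locale majorant =
  fixes \<sigma> :: real and \<mu> :: "real \<Rightarrow> real"
  assumes sigma: "1 \<le> \<sigma>"
    and mono: "mono \<mu>"
    and nonpos: "\<And>x. x \<le> 0 \<Longrightarrow> \<mu> x = 0"
    and scale: "\<And>l \<eta>. 1 < l \<Longrightarrow> 0 < \<eta> \<Longrightarrow> \<mu> (l * \<eta>) \<le> \<sigma> * l * \<mu> \<eta>"
    and lim: "(\<mu> \<longlongrightarrow> 0) (at_right 0)"
begin

lemma mono_le: "a \<le> b \<Longrightarrow> \<mu> a \<le> \<mu> b"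
  using mono by (rule monoD)

lemma nonneg [simp]: "0 \<le> \<mu> x"
  using mono_le[of "min x 0" x] nonpos[of "min x 0"] by simp

lemma measurable_mu [measurable]: "\<mu> \<in> borel_measurable borel"
  using mono by (rule borel_measurable_mono)

lemma scale_le:
  assumes "0 < b" "b \<le> a"
  shows "\<mu> a \<le> \<sigma> * (a / b) * \<mu> b"
proof (cases "a = b")
  case True
  then show ?thesis using assms sigma mult_right_mono[OF sigma nonneg[of b]] by simp
next
  case False
  then show ?thesis using scale[of "a / b" b] assms by simp
qed

text \<open>A monotone \<mu> is bounded by \<open>\<mu> b\<close> on the interval. The bound on
  \<open>h\<close> is asked at positive points only, since \<mu> vanishes elsewhere. The Lebesgue
  form is the one that Fubini's theorem uses.\<close>

lemma set_integrable_mult: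
  fixes h :: "real \<Rightarrow> real"
  assumes h: "h \<in> borel_measurable borel"
    and B: "\<And>\<eta>. a \<le> \<eta> \<Longrightarrow> 0 < \<eta> \<Longrightarrow> \<eta> \<le> b \<Longrightarrow> \<bar>h \<eta>\<bar> \<le> B"
  shows "set_integrable lborel {a..b} (\<lambda>\<eta>. \<mu> \<eta> * h \<eta>)"
proof -
  have "set_integrable lborel {a..b} (\<lambda>_. \<mu> b * B)"
    by (intro borel_integrable_atLeastAtMost' continuous_intros)
  then show ?thesis
    unfolding set_integrable_def
  proof (rule Bochner_Integration.integrable_bound)
    show "(\<lambda>\<eta>. indicat_real {a..b} \<eta> *\<^sub>R (\<mu> \<eta> * h \<eta>)) \<in> borel_measurable lborel"
      using h by measurable
    have "\<bar>\<mu> \<eta>\<bar> * \<bar>h \<eta>\<bar> \<le> \<bar>\<mu> b * B\<bar>" if "a \<le> \<eta>" "\<eta> \<le> b" for \<eta>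
    proof (cases "\<eta> \<le> 0")
      case False
      then have "\<bar>\<mu> \<eta>\<bar> * \<bar>h \<eta>\<bar> \<le> \<mu> b * B"
        using that by (intro mult_mono) (auto intro: mono_le B)
      then show ?thesis by linarith
    qed (simp add: nonpos)
    then show "AE \<eta> in lborel. norm (indicat_real {a..b} \<eta> *\<^sub>R (\<mu> \<eta> * h \<eta>))
         \<le> norm (indicat_real {a..b} \<eta> *\<^sub>R (\<mu> b * B))"
      by (intro AE_I2) (auto simp: indicator_def abs_mult)
  qed
qed

lemma integrable_mult:
  fixes h :: "real \<Rightarrow> real"
  assumes "h \<in> borel_measurable borel"
    and "\<And>\<eta>. a \<le> \<eta> \<Longrightarrow> 0 < \<eta> \<Longrightarrow> \<eta> \<le> b \<Longrightarrow> \<bar>h \<eta>\<bar> \<le> B"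
  shows "(\<lambda>\<eta>. \<mu> \<eta> * h \<eta>) integrable_on {a..b}"
  using set_integrable_mult[OF assms] by (rule set_borel_integral_eq_integral)

section \<open>Upper estimate for the density\<close>

lemma kern_majorant_integrable:
  assumes "0 < r"
  shows "(\<lambda>\<eta>. \<mu> \<eta> * (\<eta> * r\<^sup>2 / (\<eta>\<^sup>2 + r\<^sup>2)\<^sup>2)) integrable_on {0..1}"
proof (rule integrable_mult)
  show "(\<lambda>\<eta>. \<eta> * r\<^sup>2 / (\<eta>\<^sup>2 + r\<^sup>2)\<^sup>2) \<in> borel_measurable borel" by measurable
  show "\<bar>\<eta> * r\<^sup>2 / (\<eta>\<^sup>2 + r\<^sup>2)\<^sup>2\<bar> \<le> 1 / r\<^sup>2" if "0 \<le> \<eta>" "0 < \<eta>" "\<eta> \<le> 1" for \<eta>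
    using kern_majorant_le[OF assms, of \<eta>] that by simp
qed

text \<open>Monotonicity below \<open>r\<close> and the growth condition above give
  \<open>\<mu> \<eta> \<le> \<mu> r * (1 + \<sigma> * \<eta> / r)\<close>. The integrand is then
  dominated by a multiple of \<open>r / (\<eta>\<^sup>2 + r\<^sup>2)\<close>, whose integral is an
  arctangent and so bounded independently of \<open>r\<close>.\<close>

lemma kern_majorant_integral:
  assumes r: "0 < r"
  shows "integral {0..1} (\<lambda>\<eta>. \<mu> \<eta> * (\<eta> * r\<^sup>2 / (\<eta>\<^sup>2 + r\<^sup>2)\<^sup>2)) \<le> 3 * \<sigma> * \<mu> r"
proof -
  \<comment> \<open>The 1/2 comes from
    \<open>2 * \<eta> * r \<le> \<eta>\<^sup>2 + r\<^sup>2\<close>, the \<sigma> from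
    \<open>\<eta>\<^sup>2 \<le> \<eta>\<^sup>2 + r\<^sup>2\<close>.\<close>
  define K where "K = \<mu> r * (1/2 + \<sigma>)"
  have K: "0 \<le> K" using sigma by (simp add: K_def)
  have "((\<lambda>\<eta>. r / (\<eta>\<^sup>2 + r\<^sup>2)) has_integral arctan (1 / r) - arctan (0 / r)) {0..1}"
  proof (rule fundamental_theorem_of_calculus)
    fix x :: real
    have "((\<lambda>\<eta>. arctan (\<eta> / r)) has_real_derivative inverse (1 + (x / r)\<^sup>2) * (1 / r)) (at x within {0..1})"
      using r by (auto intro!: derivative_eq_intros)
    also have "inverse (1 + (x / r)\<^sup>2) * (1 / r) = r / (x\<^sup>2 + r\<^sup>2)"
      using r by (simp add: divide_simps add_nonneg_eq_0_iff) (simp add: power2_eq_square algebra_simps)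
    finally show "((\<lambda>\<eta>. arctan (\<eta> / r)) has_vector_derivative r / (x\<^sup>2 + r\<^sup>2)) (at x within {0..1})"
      by (simp add: has_real_derivative_iff_has_vector_derivative)
  qed simp
  then have hi: "((\<lambda>\<eta>. K * (r / (\<eta>\<^sup>2 + r\<^sup>2))) has_integral K * arctan (1 / r)) {0..1}"
    by (intro has_integral_mult_right) simp
  have le: "\<mu> \<eta> * (\<eta> * r\<^sup>2 / (\<eta>\<^sup>2 + r\<^sup>2)\<^sup>2) \<le> K * (r / (\<eta>\<^sup>2 + r\<^sup>2))" if \<eta>: "\<eta> \<in> {0..1}" for \<eta>
  proof -
    have q: "0 < \<eta>\<^sup>2 + r\<^sup>2" using r by (simp add: add_nonneg_pos)
    have "\<mu> \<eta> \<le> \<mu> r * (1 + \<sigma> * \<eta> / r)"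
    proof (cases "\<eta> \<le> r")
      case True
      have "\<mu> r * 1 \<le> \<mu> r * (1 + \<sigma> * \<eta> / r)"
        using r \<eta> sigma by (intro mult_left_mono) auto
      then show ?thesis using mono_le[OF True] by simp
    next
      case False
      then show ?thesis
        using scale_le[OF r, of \<eta>] nonneg[of r] by (simp add: algebra_simps del: nonneg)
    qed
    then have "\<mu> \<eta> * (\<eta> * r\<^sup>2 / (\<eta>\<^sup>2 + r\<^sup>2)\<^sup>2) \<le> \<mu> r * (1 + \<sigma> * \<eta> / r) * (\<eta> * r\<^sup>2 / (\<eta>\<^sup>2 + r\<^sup>2)\<^sup>2)"
      using \<eta> by (intro mult_right_mono) auto
    also have "\<dots> = \<mu> r * ((r * (\<eta> * r) + \<sigma> * r * \<eta>\<^sup>2) / (\<eta>\<^sup>2 + r\<^sup>2)\<^sup>2)"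
      using r q by (simp add: divide_simps) (simp add: power2_eq_square algebra_simps)
    also have "\<dots> \<le> \<mu> r * ((r * ((\<eta>\<^sup>2 + r\<^sup>2) / 2) + \<sigma> * r * (\<eta>\<^sup>2 + r\<^sup>2)) / (\<eta>\<^sup>2 + r\<^sup>2)\<^sup>2)"
      using r sigma sum_squares_bound[of \<eta> r]
      by (intro mult_left_mono divide_right_mono add_mono) auto
    also have "r * ((\<eta>\<^sup>2 + r\<^sup>2) / 2) + \<sigma> * r * (\<eta>\<^sup>2 + r\<^sup>2) = (1/2 + \<sigma>) * r * (\<eta>\<^sup>2 + r\<^sup>2)"
      by (simp add: algebra_simps)
    also have "\<mu> r * ((1/2 + \<sigma>) * r * (\<eta>\<^sup>2 + r\<^sup>2) / (\<eta>\<^sup>2 + r\<^sup>2)\<^sup>2) = K * (r / (\<eta>\<^sup>2 + r\<^sup>2))"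
      using q by (simp add: K_def power2_eq_square)
    finally show ?thesis .
  qed
  have "integral {0..1} (\<lambda>\<eta>. \<mu> \<eta> * (\<eta> * r\<^sup>2 / (\<eta>\<^sup>2 + r\<^sup>2)\<^sup>2)) \<le> K * arctan (1 / r)"
    using integral_le[OF kern_majorant_integrable[OF r] has_integral_integrable[OF hi] le]
    unfolding integral_unique[OF hi] by simp
  also have "\<dots> \<le> K * 2"
    using arctan_ubound[of "1 / r"] pi_less_4 by (intro mult_left_mono K) linarith
  also have "\<dots> = (1 + 2 * \<sigma>) * \<mu> r" by (simp add: K_def algebra_simps)
  also have "\<dots> \<le> 3 * \<sigma> * \<mu> r"
    using sigma by (intro mult_right_mono) auto
  finally show ?thesis .
qed

definition dens :: "complex \<Rightarrow> real" where
  "dens t = integral {0..1} (\<lambda>\<eta>. \<mu> \<eta> * kern \<eta> t)"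

lemma kern_set_integrable:
  assumes t: "t \<in> gam"
  shows "set_integrable lborel {0..1} (\<lambda>\<eta>. \<mu> \<eta> * kern \<eta> t)"
proof (cases "t = 0")
  case False
  have "\<bar>kern \<eta> t\<bar> \<le> 40 * (1 / (cmod t)\<^sup>2)" if "0 \<le> \<eta>" "\<eta> \<le> 1" for \<eta>
    using kern_bound[OF t that] kern_majorant_le[of "cmod t" \<eta>] that False by fastforce
  then show ?thesis by (intro set_integrable_mult[where B = "40 * (1 / (cmod t)\<^sup>2)"] measurable_kern) auto
qed (simp add: set_integrable_def)

lemma kern_integrable:
  assumes t: "t \<in> gam"
  shows "(\<lambda>\<eta>. \<mu> \<eta> * kern \<eta> t) integrable_on {0..1}"
  using kern_set_integrable[OF t] by (rule set_borel_integral_eq_integral)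

lemma abs_kern_integrable:
  assumes t: "t \<in> gam"
  shows "set_integrable lborel {0..1} (\<lambda>\<eta>. \<bar>\<mu> \<eta> * kern \<eta> t\<bar>)"
  using kern_set_integrable[OF t] by (rule set_integrable_abs)

text \<open>The modulus stands inside the integral because the same bound later justifies
  interchanging the order of integration. At \<open>t = 0\<close> both sides vanish.\<close>

lemma abs_kern_integral:
  assumes t: "t \<in> gam"
  shows "integral {0..1} (\<lambda>\<eta>. \<bar>\<mu> \<eta> * kern \<eta> t\<bar>) \<le> 120 * \<sigma> * \<mu> (cmod t)"
proof (cases "t = 0")
  case False
  then have r: "0 < cmod t" by simp
  have "integral {0..1} (\<lambda>\<eta>. \<bar>\<mu> \<eta> * kern \<eta> t\<bar>)
     \<le> integral {0..1} (\<lambda>\<eta>. 40 * (\<mu> \<eta> * (\<eta> * (cmod t)\<^sup>2 / (\<eta>\<^sup>2 + (cmod t)\<^sup>2)\<^sup>2)))"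
  proof (rule integral_le)
    fix \<eta> :: real assume "\<eta> \<in> {0..1}"
    then have "\<mu> \<eta> * \<bar>kern \<eta> t\<bar> \<le> \<mu> \<eta> * (40 * (\<eta> * (cmod t)\<^sup>2 / (\<eta>\<^sup>2 + (cmod t)\<^sup>2)\<^sup>2))"
      by (intro mult_left_mono kern_bound t) auto
    then show "\<bar>\<mu> \<eta> * kern \<eta> t\<bar> \<le> 40 * (\<mu> \<eta> * (\<eta> * (cmod t)\<^sup>2 / (\<eta>\<^sup>2 + (cmod t)\<^sup>2)\<^sup>2))"
      by (simp add: abs_mult mult_ac)
  qed (intro set_borel_integral_eq_integral(1)[OF abs_kern_integrable[OF t]]
      integrable_on_mult_right kern_majorant_integrable r)+
  also have "\<dots> \<le> 40 * (3 * \<sigma> * \<mu> (cmod t))"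
    unfolding integral_mult_right by (intro mult_left_mono kern_majorant_integral r) auto
  finally show ?thesis by simp
qed (simp add: nonpos)

lemma dens_bound:
  assumes t: "t \<in> gam"
  shows "\<bar>dens t\<bar> \<le> 120 * \<sigma> * \<mu> (cmod t)"
proof -
  have "norm (dens t) \<le> integral {0..1} (\<lambda>\<eta>. \<bar>\<mu> \<eta> * kern \<eta> t\<bar>)"
    unfolding dens_def
    by (intro integral_norm_bound_integral kern_integrable t
        set_borel_integral_eq_integral(1)[OF abs_kern_integrable[OF t]]) auto
  then show ?thesis using abs_kern_integral[OF t] by simp
qed

text \<open>If both points lie within \<open>2 * \<epsilon>\<close> of the origin, the two values
  are small separately. Otherwise both moduli exceed \<epsilon> and are comparable, and the
  increment of the kernel gains a factor \<open>\<epsilon> / r\<close>.\<close>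

lemma dens_diff:
  assumes t: "t1 \<in> gam" "t2 \<in> gam" and le: "cmod (t1 - t2) \<le> \<epsilon>" and \<epsilon>: "0 < \<epsilon>"
    and r: "cmod t2 \<le> cmod t1"
  shows "\<bar>dens t1 - dens t2\<bar> \<le> 1800 * \<sigma>\<^sup>2 * \<mu> \<epsilon>"
proof (cases "cmod t1 \<le> 2 * \<epsilon>")
  case True
  have "\<mu> (cmod t1) \<le> \<sigma> * 2 * \<mu> \<epsilon>" "\<mu> (cmod t2) \<le> \<sigma> * 2 * \<mu> \<epsilon>"
    using mono_le[OF True] mono_le[OF order.trans[OF r True]] scale[of 2 \<epsilon>] \<epsilon> by auto
  then have "120 * \<sigma> * \<mu> (cmod t1) + 120 * \<sigma> * \<mu> (cmod t2)
       \<le> 120 * \<sigma> * (\<sigma> * 2 * \<mu> \<epsilon>) + 120 * \<sigma> * (\<sigma> * 2 * \<mu> \<epsilon>)"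
    using sigma by (intro add_mono mult_left_mono) auto
  also have "\<dots> = 480 * \<sigma>\<^sup>2 * \<mu> \<epsilon>" by (simp add: power2_eq_square)
  also have "\<dots> \<le> 1800 * \<sigma>\<^sup>2 * \<mu> \<epsilon>" by (intro mult_right_mono) auto
  finally show ?thesis using dens_bound[OF t(1)] dens_bound[OF t(2)] by linarith
next
  case False
  define r where "r = cmod t2"
  have r1: "r \<le> cmod t1" "cmod t1 \<le> r + \<epsilon>"
    using le r norm_triangle_sub[of t1 t2] by (auto simp: r_def)
  then have r\<epsilon>: "\<epsilon> < r" and r0: "0 < r" and nz: "t1 \<noteq> 0" "t2 \<noteq> 0"
    using False \<epsilon> by (auto simp: r_def)
  have ig: "(\<lambda>\<eta>. 600 * (\<epsilon> / r) * (\<mu> \<eta> * (\<eta> * r\<^sup>2 / (\<eta>\<^sup>2 + r\<^sup>2)\<^sup>2))) integrable_on {0..1}"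
    by (intro integrable_on_mult_right kern_majorant_integrable r0)
  have "\<bar>dens t1 - dens t2\<bar> = norm (integral {0..1} (\<lambda>\<eta>. \<mu> \<eta> * kern \<eta> t1 - \<mu> \<eta> * kern \<eta> t2))"
    unfolding dens_def using Henstock_Kurzweil_Integration.integral_diff[OF kern_integrable[OF t(1)] kern_integrable[OF t(2)]]
    by simp
  also have "\<dots> \<le> integral {0..1} (\<lambda>\<eta>. 600 * (\<epsilon> / r) * (\<mu> \<eta> * (\<eta> * r\<^sup>2 / (\<eta>\<^sup>2 + r\<^sup>2)\<^sup>2)))"
  proof (rule integral_norm_bound_integral)
    fix \<eta> :: real assume \<eta>: "\<eta> \<in> {0..1}"
    have "\<bar>kern \<eta> t1 - kern \<eta> t2\<bar> \<le> 200 * (\<eta> * (cmod (t1 - t2) * (cmod t1 + cmod t2))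
           / ((\<eta>\<^sup>2 + (cmod t1)\<^sup>2) * (\<eta>\<^sup>2 + (cmod t2)\<^sup>2)))"
      using \<eta> by (intro kern_diff_bound t nz) auto
    \<comment> \<open>Here \<open>cmod t1 + cmod t2 \<le> 2 * r + \<epsilon> \<le> 3 * r\<close>,
      and \<open>cmod t1\<close> is replaced by the smaller \<open>r\<close> in the
      denominator.\<close>
    also have "\<dots> \<le> 200 * (\<eta> * (\<epsilon> * (3 * r)) / ((\<eta>\<^sup>2 + r\<^sup>2) * (\<eta>\<^sup>2 + r\<^sup>2)))"
      using \<eta> r1 r\<epsilon> r0 \<epsilon> le unfolding r_def[symmetric]
      by (intro mult_left_mono frac_le mult_mono add_left_mono power_mono mult_pos_pos add_nonneg_pos) auto
    also have "\<dots> = 600 * (\<epsilon> / r) * (\<eta> * r\<^sup>2 / (\<eta>\<^sup>2 + r\<^sup>2)\<^sup>2)"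
      using r0 by (simp add: power2_eq_square field_simps)
    finally have "\<mu> \<eta> * \<bar>kern \<eta> t1 - kern \<eta> t2\<bar> \<le> \<mu> \<eta> * (600 * (\<epsilon> / r) * (\<eta> * r\<^sup>2 / (\<eta>\<^sup>2 + r\<^sup>2)\<^sup>2))"
      by (intro mult_left_mono) auto
    then show "norm (\<mu> \<eta> * kern \<eta> t1 - \<mu> \<eta> * kern \<eta> t2)
       \<le> 600 * (\<epsilon> / r) * (\<mu> \<eta> * (\<eta> * r\<^sup>2 / (\<eta>\<^sup>2 + r\<^sup>2)\<^sup>2))"
      unfolding right_diff_distrib[symmetric] by (simp add: abs_mult mult_ac)
  qed (use ig kern_integrable t in \<open>auto intro!: integrable_diff\<close>)
  also have "\<dots> = 600 * (\<epsilon> / r) * integral {0..1} (\<lambda>\<eta>. \<mu> \<eta> * (\<eta> * r\<^sup>2 / (\<eta>\<^sup>2 + r\<^sup>2)\<^sup>2))"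
    by (rule integral_mult_right)
  \<comment> \<open>The growth condition bounds \<open>\<mu> r\<close> by
    \<open>\<sigma> * (r / \<epsilon>) * \<mu> \<epsilon>\<close>; its factor
    \<open>r / \<epsilon>\<close> exactly cancels the gain \<open>\<epsilon> / r\<close>.\<close>
  also have "\<dots> \<le> 600 * (\<epsilon> / r) * (3 * \<sigma> * (\<sigma> * (r / \<epsilon>) * \<mu> \<epsilon>))"
    using kern_majorant_integral[OF r0] scale_le[OF \<epsilon>, of r] r\<epsilon> r0 \<epsilon> sigma
    by (intro mult_left_mono order.trans[OF kern_majorant_integral]) auto
  also have "\<dots> = 1800 * \<sigma>\<^sup>2 * \<mu> \<epsilon>" using r0 \<epsilon> by (simp add: power2_eq_square)
  finally show ?thesis .
qed

lemma modulus_dens: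
  assumes "0 \<le> \<epsilon>"
  shows "modulus_cont gam dens \<epsilon> \<le> ereal (1800 * \<sigma>\<^sup>2 * \<mu> \<epsilon>)"
  unfolding modulus_cont_def
proof (rule Sup_least, clarify)
  fix t1 t2 assume t: "t1 \<in> gam" "t2 \<in> gam" "cmod (t1 - t2) \<le> \<epsilon>"
  have "\<bar>dens t1 - dens t2\<bar> \<le> 1800 * \<sigma>\<^sup>2 * \<mu> \<epsilon>"
  \<comment> \<open>For \<epsilon> = 0 the points coincide; \<open>dens_diff\<close> covers positive
    \<epsilon>.\<close>
  proof (cases "\<epsilon> = 0")
    case False
    then show ?thesis
      using dens_diff[of t1 t2 \<epsilon>] dens_diff[of t2 t1 \<epsilon>] t assms
      by (cases "cmod t1 \<le> cmod t2") (auto simp: abs_minus_commute norm_minus_commute)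
  qed (use t in simp)
  then show "ereal (norm (dens t1 - dens t2)) \<le> ereal (1800 * \<sigma>\<^sup>2 * \<mu> \<epsilon>)" by simp
qed

lemma continuous_on_dens: "continuous_on gam dens"
proof (clarsimp simp: continuous_on_iff)
  fix e :: real and x assume x: "x \<in> gam" and e: "0 < e"
  define C where "C = 1800 * \<sigma>\<^sup>2"
  have C: "0 < C" using sigma by (simp add: C_def)
  have "\<forall>\<^sub>F \<epsilon> in at_right 0. \<mu> \<epsilon> < e / C"
    using lim e C by (intro order_tendstoD(2)) auto
  then obtain d where d: "0 < d" "\<mu> d < e / C"
    unfolding eventually_at_right_field by (metis dense)
  have "dist (dens y) (dens x) < e" if y: "y \<in> gam" "dist y x < d" for y
  proof -
    have "\<bar>dens y - dens x\<bar> \<le> C * \<mu> d"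
      using dens_diff[of x y d] dens_diff[of y x d] x y d unfolding C_def
      by (cases "cmod x \<le> cmod y") (auto simp: abs_minus_commute norm_minus_commute dist_norm)
    also have "\<dots> < e" using d C by (simp add: field_simps)
    finally show ?thesis by (simp add: dist_norm)
  qed
  then show "\<exists>d>0. \<forall>x'\<in>gam. dist x' x < d \<longrightarrow> dist (dens x') (dens x) < e"
    using d(1) by blast
qed

end

section \<open>The Cauchy-type integral in the parameter of the circle\<close>

definition circ :: "real \<Rightarrow> complex" where
  "circ x = -1 + cis (2 * pi * x)"

text \<open>For \<open>0 \<le> \<rho> < 1\<close> this is half the sum of 1 and the Poisson kernel
  of the unit disc at \<rho>; it is the real part of the Cauchy kernel for the point
  \<open>\<rho> - 1\<close>.\<close>

definition circ_kern :: "real \<Rightarrow> real \<Rightarrow> real" where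
  "circ_kern \<rho> x = Re (cis (2 * pi * x) / (cis (2 * pi * x) - \<rho>))"

lemma circ_in_gam [simp]: "circ x \<in> gam"
  by (simp add: circ_def gam_def)

lemma circlepath_eq_circ: "circlepath (-1) 1 x = circ x"
  by (simp add: circlepath circ_def cis_conv_exp mult_ac)

lemma continuous_on_circ [continuous_intros]: "continuous_on A circ"
  unfolding circ_def by (intro continuous_intros)

lemma has_contour_integral_circ:
  "(h has_contour_integral I) (circlepath (-1) 1) \<longleftrightarrow>
     ((\<lambda>x. h (circ x) * (2 * pi * \<i> * cis (2 * pi * x))) has_integral I) {0..1}"
  unfolding has_contour_integral_def
proof (rule has_integral_cong)
  fix x :: real assume "x \<in> {0..1}"
  then have "vector_derivative (circlepath (-1) 1) (at x within {0..1})
      = 2 * pi * \<i> * exp (2 * pi * \<i> * x)"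
    using vector_derivative_circlepath01[of x "-1" 1] by simp
  then show "h (circlepath (-1) 1 x) * vector_derivative (circlepath (-1) 1) (at x within {0..1})
      = h (circ x) * (2 * pi * \<i> * cis (2 * pi * x))"
    by (simp add: circlepath_eq_circ cis_conv_exp mult_ac)
qed

lemma cauchy_integral_circ:
  assumes "continuous_on (cball (-1) 1) F" "F holomorphic_on ball (-1) 1" "cmod (w + 1) < 1"
  shows "((\<lambda>x. F (circ x) * (cis (2 * pi * x) / (circ x - w))) has_integral F w) {0..1}"
proof -
  have "((\<lambda>u. F u / (u - w)) has_contour_integral (2 * pi * \<i> * F w)) (circlepath (-1) 1)"
    using Cauchy_integral_circlepath[OF assms(1,2), of w] assms(3) by simp
  then have "((\<lambda>x. F (circ x) / (circ x - w) * (2 * pi * \<i> * cis (2 * pi * x)))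
      has_integral 2 * pi * \<i> * F w) {0..1}"
    by (simp only: has_contour_integral_circ)
  from has_integral_mult_right[OF this, of "1 / (2 * pi * \<i>)"] show ?thesis
    by (simp add: mult_ac)
qed

lemma cnj_circ_kern:
  "cnj (cis y / (cis y - complex_of_real \<rho>)) = 1 / (1 - \<rho> * cis y)"
proof -
  have "cnj (cis y) = 1 / cis y" by (simp add: cis_cnj cis_inverse[symmetric] field_simps)
  then have "cnj (cis y / (cis y - complex_of_real \<rho>)) = (1 / cis y) / (1 / cis y - \<rho>)"
    by (simp only: complex_cnj_divide complex_cnj_diff complex_cnj_complex_of_real)
  then show ?thesis by (simp add: divide_simps)
qed

lemma circ_kern_complex:
  "complex_of_real (circ_kern \<rho> x) =
    (cis (2 * pi * x) / (cis (2 * pi * x) - \<rho>) + 1 / (1 - \<rho> * cis (2 * pi * x))) / 2"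
proof -
  define e where "e = cis (2 * pi * x)"
  have "e / (e - \<rho>) + 1 / (1 - \<rho> * e) = of_real (2 * Re (e / (e - \<rho>)))"
    unfolding e_def cnj_circ_kern[symmetric] by (rule complex_add_cnj)
  then show ?thesis by (simp add: circ_kern_def e_def)
qed

text \<open>By \<open>circ_kern_complex\<close> the kernel is half the sum of the Cauchy kernel and
  its conjugate. The first reproduces \<open>F (\<rho> - 1)\<close>. The conjugate equals
  \<open>1 / (1 - \<rho> * (t + 1))\<close> on the circle, which is holomorphic inside, so it yields
  a value at the centre.\<close>

lemma holomorphic_circ_kern_integral:
  assumes F: "F holomorphic_on cball (-1) 1" and \<rho>: "0 \<le> \<rho>" "\<rho> < 1"
  shows "((\<lambda>x. Re (F (circ x)) * circ_kern \<rho> x) has_integral Re (F (\<rho> - 1) + F (-1)) / 2) {0..1}"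
proof -
  have nz: "1 - \<rho> * (t + 1) \<noteq> 0" if "t \<in> cball (-1) 1" for t :: complex
  proof
    assume "1 - \<rho> * (t + 1) = 0"
    then have "1 = cmod (\<rho> * (t + 1))" by simp
    also have "\<dots> = \<rho> * cmod (t + 1)" using \<rho> by (simp add: norm_mult)
    also have "\<dots> \<le> \<rho> * 1"
      using that \<rho> by (intro mult_left_mono) (auto simp: dist_norm norm_minus_commute add.commute)
    finally show False using \<rho> by simp
  qed
  have F2: "(\<lambda>t. F t / (1 - \<rho> * (t + 1))) holomorphic_on cball (-1) 1"
    using nz by (intro holomorphic_intros F) auto
  have 1: "((\<lambda>x. F (circ x) * (cis (2 * pi * x) / (circ x - (\<rho> - 1)))) has_integral F (\<rho> - 1)) {0..1}"
    using F \<rho> by (intro cauchy_integral_circ holomorphic_on_imp_continuous_on) auto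
  \<comment> \<open>The factor \<open>cis (2 * pi * x) / (circ x - (-1))\<close> equals 1, so this
    is the mean value property at the centre -1.\<close>
  have "((\<lambda>x. F (circ x) / (1 - \<rho> * (circ x + 1)) * (cis (2 * pi * x) / (circ x - (-1))))
       has_integral F (-1) / (1 - complex_of_real \<rho> * (-1 + 1))) {0..1}"
    using F2 by (intro cauchy_integral_circ holomorphic_on_imp_continuous_on) auto
  from has_integral_add[OF 1 this]
  have "((\<lambda>x. F (circ x) * (cis (2 * pi * x) / (cis (2 * pi * x) - \<rho>) + 1 / (1 - \<rho> * cis (2 * pi * x))))
      has_integral F (\<rho> - 1) + F (-1)) {0..1}"
    by (simp add: circ_def algebra_simps)
  from has_integral_mult_right[OF this, of "1/2"]
  have "((\<lambda>x. F (circ x) * complex_of_real (circ_kern \<rho> x)) has_integral (F (\<rho> - 1) + F (-1)) / 2) {0..1}"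
    unfolding circ_kern_complex by simp
  from has_integral_Re[OF this] show ?thesis by simp
qed

lemma continuous_on_circ_kern:
  assumes "0 \<le> \<rho>" "\<rho> < 1" shows "continuous_on A (circ_kern \<rho>)"
proof -
  have "cis y - complex_of_real \<rho> \<noteq> 0" for y
    using assms by (metis norm_cis norm_of_real abs_of_nonneg less_irrefl right_minus_eq)
  then show ?thesis unfolding circ_kern_def by (intro continuous_intros) auto
qed

text \<open>Reflection in the unit circle sends \<rho> to \<open>1 / \<rho>\<close>, and on the
  circle the two Cauchy kernels are related by one minus the conjugate. This carries the interior
  computation over to exterior points.\<close>

lemma circ_kern_reflect:
  assumes "0 < \<rho>" "\<rho> < 1"
  shows "Re (cis (2 * pi * x) / (cis (2 * pi * x) - complex_of_real (1 / \<rho>))) = 1 - circ_kern \<rho> x"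
proof -
  define e where "e = cis (2 * pi * x)"
  have "1 - \<rho> * e \<noteq> 0"
  proof
    assume "1 - \<rho> * e = 0"
    then have "1 = cmod (\<rho> * e)" by simp
    then show False using assms by (simp add: norm_mult e_def)
  qed
  then have "e / (e - complex_of_real (1 / \<rho>)) = 1 - cnj (e / (e - \<rho>))"
    unfolding e_def cnj_circ_kern using assms by (simp add: divide_simps) (simp add: algebra_simps)
  then have "Re (e / (e - complex_of_real (1 / \<rho>))) = 1 - Re (e / (e - \<rho>))"
    by (metis cnj.sel(1) minus_complex.sel(1) one_complex.sel(1))
  then show ?thesis by (simp add: circ_kern_def e_def)
qed

text \<open>The derivative of the parametrisation absorbs the factor in front of the contour
  integral, and since \<open>g\<close> is real the real part falls on the kernel alone.\<close>

lemma Re_cauchy_type: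
  assumes g: "continuous_on gam g" and z: "z \<notin> gam"
  shows "Re (cauchy_type g z) = integral {0..1} (\<lambda>x. g (circ x) * Re (cis (2 * pi * x) / (circ x - z)))"
proof -
  define I where "I = integral {0..1} (\<lambda>x. complex_of_real (g (circ x)) * (cis (2 * pi * x) / (circ x - z)))"
  have "circ x - z \<noteq> 0" for x using z circ_in_gam[of x] by force
  then have "(\<lambda>x. complex_of_real (g (circ x)) * (cis (2 * pi * x) / (circ x - z))) integrable_on {0..1}"
    by (intro integrable_continuous_interval continuous_intros continuous_on_compose2[OF g]) auto
  then have I: "((\<lambda>x. complex_of_real (g (circ x)) * (cis (2 * pi * x) / (circ x - z))) has_integral I) {0..1}"
    by (simp add: I_def integrable_integral)
  from has_integral_mult_right[OF this, of "2 * pi * \<i>"]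
  have "((\<lambda>t. complex_of_real (g t) / (t - z)) has_contour_integral (2 * pi * \<i> * I)) (circlepath (-1) 1)"
    by (simp add: has_contour_integral_circ mult_ac)
  then have "cauchy_type g z = I"
    by (simp add: cauchy_type_def contour_integral_unique)
  then show ?thesis using integral_unique[OF has_integral_Re[OF I]] by (simp del: times_divide_eq_right)
qed

lemma measurable_cis [measurable]: "cis \<in> borel_measurable borel"
  by (intro borel_measurable_continuous_onI continuous_intros)

section \<open>The Cauchy-type integral of the density on the real axis\<close>

context majorant
begin

text \<open>The function \<open>U\<close> of the overview.\<close>

definition pot :: "real \<Rightarrow> real" where
  "pot x = integral {0..1} (\<lambda>\<eta>. \<mu> \<eta> * (x / (x + \<eta>)\<^sup>2))"

lemma pot_integrable:
  assumes "0 < x" shows "(\<lambda>\<eta>. \<mu> \<eta> * (x / (x + \<eta>)\<^sup>2)) integrable_on {0..1}"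
  by (rule integrable_mult[where B = "1 / x"]) (measurable, use pot_kern_le assms in auto)

lemma pot_set_integrable:
  assumes "0 < x" shows "set_integrable lborel {0..1} (\<lambda>\<eta>. \<mu> \<eta> * (x / (x + \<eta>)\<^sup>2))"
  by (rule set_integrable_mult[where B = "1 / x"]) (measurable, use pot_kern_le assms in auto)

lemma pot_nonneg: "0 < x \<Longrightarrow> 0 \<le> pot x"
  unfolding pot_def by (intro integral_nonneg pot_integrable) auto

text \<open>Replace the kernel by the real part of \<open>holo_kern\<close> and apply Cauchy's
  formula with \<open>\<rho> - 1 = -x\<close>. The three terms are the integrands of
  \<open>pot\<close> at \<open>x\<close>, \<open>x / (1 - x)\<close> and 1, without \<mu>.\<close>

lemma kern_circ_kern_integral:
  assumes \<eta>: "0 < \<eta>" "\<eta> \<le> 1" and x: "0 < x" "x < 1"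
  shows "(LINT y:{0..1}|lborel. kern \<eta> (circ y) * circ_kern (1 - x) y) =
    - (x / (x + \<eta>)\<^sup>2 + (x / (1 - x)) / (x / (1 - x) + \<eta>)\<^sup>2 + 1 / (1 + \<eta>)\<^sup>2)"
proof -
  have eq: "kern \<eta> (circ y) = Re (holo_kern \<eta> (circ y))" for y
    using \<eta> by (intro kern_eq_Re_holo_kern) auto
  have hol: "holo_kern \<eta> holomorphic_on cball (-1) 1"
    using \<eta> by (rule holo_kern_holomorphic)
  have "continuous_on {0..1} (\<lambda>y. kern \<eta> (circ y) * circ_kern (1 - x) y)"
    unfolding eq using x
    by (intro continuous_intros continuous_on_circ_kern
        continuous_on_compose2[OF holomorphic_on_imp_continuous_on[OF hol]])
       (auto simp: circ_def dist_norm)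
  then have "(LINT y:{0..1}|lborel. kern \<eta> (circ y) * circ_kern (1 - x) y)
     = integral {0..1} (\<lambda>y. kern \<eta> (circ y) * circ_kern (1 - x) y)"
    by (intro set_borel_integral_eq_integral borel_integrable_atLeastAtMost')
  \<comment> \<open>The argument \<open>- of_real 1\<close> is the centre of the circle; the second
    summand of \<open>holo_kern\<close> vanishes there.\<close>
  also have "\<dots> = Re (holo_kern \<eta> (- of_real x) + holo_kern \<eta> (- of_real 1)) / 2"
    using holomorphic_circ_kern_integral[OF hol, of "1 - x"] x unfolding eq
    by (intro integral_unique) (simp del: plus_complex.sel)
  also have "\<dots> = - (x / (x + \<eta>)\<^sup>2 + x * (1 - x) / (\<eta> + (1 - \<eta>) * x)\<^sup>2 + 1 / (1 + \<eta>)\<^sup>2)"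
    unfolding holo_kern_real by (simp add: field_simps)
  also have "x * (1 - x) / (\<eta> + (1 - \<eta>) * x)\<^sup>2 = (x / (1 - x)) / (x / (1 - x) + \<eta>)\<^sup>2"
  proof -
    have "x / (1 - x) + \<eta> = (\<eta> + (1 - \<eta>) * x) / (1 - x)" using x by (simp add: field_simps)
    then show ?thesis using x by (simp add: power2_eq_square)
  qed
  finally show ?thesis .
qed

text \<open>Interchange the integrals over the circle and over \<eta>. Absolute integrability
  follows from \<open>abs_kern_integral\<close>, uniformly on the circle since
  \<open>cmod t \<le> 2\<close> there, and from the boundedness of \<open>circ_kern\<close> on the
  unit interval.\<close>

lemma integral_dens_circ_kern:
  assumes x: "0 < x" "x < 1"
  shows "integral {0..1} (\<lambda>y. dens (circ y) * circ_kern (1 - x) y) =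
    - (pot x + pot (x / (1 - x)) + pot 1)"
proof -
  \<comment> \<open>Indicators carry both intervals, so that Fubini's theorem applies on the product
    of two full lines.\<close>
  define f where "f y \<eta> = indicat_real {0..1} y * (circ_kern (1 - x) y *
      (indicat_real {0..1} \<eta> * (\<mu> \<eta> * kern \<eta> (circ y))))" for y \<eta>
  have cQ: "continuous_on {0..1} (circ_kern (1 - x))"
    using x by (intro continuous_on_circ_kern) auto
  have "\<exists>B. \<forall>y\<in>{0..1}. \<bar>circ_kern (1 - x) y\<bar> \<le> B"
    using compact_imp_bounded[OF compact_continuous_image[OF cQ]] by (simp add: bounded_iff)
  then obtain B where B: "\<And>y. y \<in> {0..1} \<Longrightarrow> \<bar>circ_kern (1 - x) y\<bar> \<le> B"
    by blast
  have int: "integrable (lborel \<Otimes>\<^sub>M lborel) (case_prod f)"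
  proof (rule lborel_pair.Fubini_integrable)
    show meas [measurable]: "case_prod f \<in> borel_measurable (lborel \<Otimes>\<^sub>M lborel)"
      unfolding f_def kern_def circ_def circ_kern_def by measurable
    have "set_integrable lborel {0..1::real} (\<lambda>_. B * (120 * \<sigma> * \<mu> 2))"
      by (intro borel_integrable_atLeastAtMost' continuous_intros)
    then show "integrable lborel (\<lambda>y. LINT \<eta>|lborel. norm (case_prod f (y, \<eta>)))"
      unfolding set_integrable_def
    proof (rule Bochner_Integration.integrable_bound)
      have "(LINT \<eta>|lborel. norm (f y \<eta>)) \<le> B * (120 * \<sigma> * \<mu> 2)" if "y \<in> {0..1}" for y
      proof -
        have "(LINT \<eta>|lborel. norm (f y \<eta>)) =
          \<bar>circ_kern (1 - x) y\<bar> * (LINT \<eta>:{0..1}|lborel. \<bar>\<mu> \<eta> * kern \<eta> (circ y)\<bar>)"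
          using that by (simp add: f_def set_lebesgue_integral_def abs_mult)
        also have "\<dots> = \<bar>circ_kern (1 - x) y\<bar> * integral {0..1} (\<lambda>\<eta>. \<bar>\<mu> \<eta> * kern \<eta> (circ y)\<bar>)"
          by (simp only: set_borel_integral_eq_integral[OF abs_kern_integrable[OF circ_in_gam]])
        also have "\<dots> \<le> B * (120 * \<sigma> * \<mu> 2)"
        proof (rule mult_mono)
          have "120 * \<sigma> * \<mu> (cmod (circ y)) \<le> 120 * \<sigma> * \<mu> 2"
            using sigma by (intro mult_left_mono mono_le gam_norm_le) auto
          then show "integral {0..1} (\<lambda>\<eta>. \<bar>\<mu> \<eta> * kern \<eta> (circ y)\<bar>) \<le> 120 * \<sigma> * \<mu> 2"
            using abs_kern_integral[OF circ_in_gam, of y] by linarith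
          show "0 \<le> integral {0..1} (\<lambda>\<eta>. \<bar>\<mu> \<eta> * kern \<eta> (circ y)\<bar>)"
            by (intro integral_nonneg set_borel_integral_eq_integral(1)[OF abs_kern_integrable]) auto
        qed (use B[OF that] in auto)
        finally show ?thesis .
      qed
      then show "AE y in lborel. norm (LINT \<eta>|lborel. norm (case_prod f (y, \<eta>)))
          \<le> norm (indicat_real {0..1} y *\<^sub>R (B * (120 * \<sigma> * \<mu> 2)))"
        by (intro AE_I2) (fastforce simp: indicator_def f_def)
    qed (use meas in measurable)
    show "AE y in lborel. integrable lborel (\<lambda>\<eta>. case_prod f (y, \<eta>))"
      using kern_set_integrable[OF circ_in_gam]
      by (intro AE_I2) (auto simp: f_def set_integrable_def)
  qed
  have inner1: "(LINT \<eta>|lborel. f y \<eta>) = indicat_real {0..1} y *\<^sub>R (dens (circ y) * circ_kern (1 - x) y)" for y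
    using set_borel_integral_eq_integral(2)[OF kern_set_integrable[OF circ_in_gam[of y]]]
    by (simp add: f_def set_lebesgue_integral_def dens_def)
  have inner2: "(LINT y|lborel. f y \<eta>) = - (indicat_real {0..1} \<eta> *\<^sub>R (\<mu> \<eta> * (x / (x + \<eta>)\<^sup>2)
      + \<mu> \<eta> * ((x / (1 - x)) / (x / (1 - x) + \<eta>)\<^sup>2) + \<mu> \<eta> * (1 / (1 + \<eta>)\<^sup>2)))" for \<eta>
  proof -
    have "(LINT y|lborel. f y \<eta>) = indicat_real {0..1} \<eta> * \<mu> \<eta> *
        (LINT y:{0..1}|lborel. kern \<eta> (circ y) * circ_kern (1 - x) y)"
      unfolding set_lebesgue_integral_def integral_mult_right_zero[symmetric]
      by (simp add: f_def mult_ac)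
    then show ?thesis
      \<comment> \<open>The formula for the inner integral requires \<eta> > 0; at \<eta> = 0 both
        sides vanish because \<open>\<mu> 0 = 0\<close>.\<close>
      using kern_circ_kern_integral[of \<eta> x] x nonpos[of \<eta>]
      by (cases "0 < \<eta> \<and> \<eta> \<le> 1") (auto simp: indicator_def algebra_simps)
  qed
  have "integral {0..1} (\<lambda>y. dens (circ y) * circ_kern (1 - x) y)
      = (LINT y|lborel. indicat_real {0..1} y *\<^sub>R (dens (circ y) * circ_kern (1 - x) y))"
    unfolding set_lebesgue_integral_def[symmetric]
    by (intro set_borel_integral_eq_integral(2)[symmetric] borel_integrable_atLeastAtMost' continuous_intros cQ
        continuous_on_compose2[OF continuous_on_dens]) auto
  also have "\<dots> = (LINT \<eta>|lborel. LINT y|lborel. f y \<eta>)"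
    unfolding lborel_pair.Fubini_integral[OF int] inner1 ..
  also have "\<dots> = - (LINT \<eta>:{0..1}|lborel. \<mu> \<eta> * (x / (x + \<eta>)\<^sup>2)
      + \<mu> \<eta> * ((x / (1 - x)) / (x / (1 - x) + \<eta>)\<^sup>2) + \<mu> \<eta> * (1 / (1 + \<eta>)\<^sup>2))"
    unfolding set_lebesgue_integral_def inner2 by simp
  also have "(LINT \<eta>:{0..1}|lborel. \<mu> \<eta> * (x / (x + \<eta>)\<^sup>2)
      + \<mu> \<eta> * ((x / (1 - x)) / (x / (1 - x) + \<eta>)\<^sup>2) + \<mu> \<eta> * (1 / (1 + \<eta>)\<^sup>2))
      = pot x + pot (x / (1 - x)) + pot 1"
  proof -
    have s: "0 < x / (1 - x)" using x by simp
    have pot: "(LINT \<eta>:{0..1}|lborel. \<mu> \<eta> * (a / (a + \<eta>)\<^sup>2)) = pot a" if "0 < a" for a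
      unfolding pot_def using pot_set_integrable[OF that] by (rule set_borel_integral_eq_integral)
    show ?thesis
      using pot[OF x(1)] pot[OF s] pot[of 1] pot_set_integrable[OF x(1)] pot_set_integrable[OF s] pot_set_integrable[of 1]
      by (simp del: times_divide_eq_right divide_divide_eq_left)
  qed
  finally show ?thesis .
qed

lemma Re_cauchy_type_inside:
  assumes x: "0 < x" "x < 1"
  shows "Re (cauchy_type dens (- of_real x)) = - (pot x + pot (x / (1 - x)) + pot 1)"
proof -
  have "cmod (- of_real x + 1) = cmod (of_real (1 - x))" by simp
  then have "- of_real x \<notin> gam"
    unfolding gam_def mem_Collect_eq norm_of_real using x by (simp del: of_real_diff)
  moreover have "circ y - (- of_real x) = cis (2 * pi * y) - complex_of_real (1 - x)" for y
    by (simp add: circ_def)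
  ultimately show ?thesis
    using integral_dens_circ_kern[OF x]
    by (simp only: Re_cauchy_type[OF continuous_on_dens] circ_kern_def not_False_eq_True)
qed

text \<open>Relative to the centre -1 the point \<open>x\<close> lies at distance
  \<open>1 + x\<close>. Its reflection is \<open>-x'\<close> with \<open>x' = x / (1 + x)\<close>,
  and \<open>x' / (1 - x') = x\<close>, so the interior formula at \<open>x'\<close> involves
  \<open>pot\<close> at \<open>x'\<close> and at \<open>x\<close>.\<close>

lemma Re_cauchy_type_outside:
  assumes x: "0 < x"
  shows "Re (cauchy_type dens (of_real x)) =
    integral {0..1} (\<lambda>y. dens (circ y)) + pot x + pot (x / (1 + x)) + pot 1"
proof -
  define \<rho> where "\<rho> = 1 / (1 + x)"
  have \<rho>: "0 < \<rho>" "\<rho> < 1" and inv: "1 / \<rho> = 1 + x" using x by (auto simp: \<rho>_def)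
  have cd: "continuous_on {0..1} (\<lambda>y. dens (circ y))"
    by (intro continuous_intros continuous_on_compose2[OF continuous_on_dens]) auto
  have cdk: "continuous_on {0..1} (\<lambda>y. dens (circ y) * circ_kern \<rho> y)"
    using \<rho> by (intro continuous_intros cd continuous_on_circ_kern) auto
  have "cmod (of_real x + 1) = \<bar>x + 1\<bar>" by (metis norm_of_real of_real_1 of_real_add)
  then have "of_real x \<notin> gam" using x by (simp add: gam_def)
  moreover have "circ y - of_real x = cis (2 * pi * y) - complex_of_real (1 / \<rho>)" for y
    by (simp add: inv circ_def)
  ultimately have "Re (cauchy_type dens (of_real x)) =
      integral {0..1} (\<lambda>y. dens (circ y) * (1 - circ_kern \<rho> y))"
    by (simp only: Re_cauchy_type[OF continuous_on_dens] circ_kern_reflect[OF \<rho>] not_False_eq_True)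
  also have "\<dots> = integral {0..1} (\<lambda>y. dens (circ y)) - integral {0..1} (\<lambda>y. dens (circ y) * circ_kern \<rho> y)"
    using cd cdk by (simp add: right_diff_distrib integral_diff integrable_continuous_interval)
  also have "integral {0..1} (\<lambda>y. dens (circ y) * circ_kern \<rho> y) = - (pot (x / (1 + x)) + pot x + pot 1)"
  proof -
    have "\<rho> = 1 - x / (1 + x)" "x / (1 + x) / (1 - x / (1 + x)) = x"
      using x by (auto simp: \<rho>_def field_simps)
    then show ?thesis
      using integral_dens_circ_kern[of "x / (1 + x)"] x by simp
  qed
  finally show ?thesis by simp
qed

section \<open>Decay of the potential at 0\<close>

text \<open>Split at \<open>h\<close>: below it \<mu> is at most \<open>\<mu> h\<close> and the
  kernel has mass at most 1; above it the kernel is at most \<open>x / h\<^sup>2\<close> and \<mu>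
  at most \<open>\<mu> 1\<close>.\<close>

lemma pot_le:
  assumes x: "0 < x" and h: "0 < h"
  shows "pot x \<le> \<mu> h + \<mu> 1 * (x / h\<^sup>2)"
proof -
  have c: "((\<lambda>_. \<mu> 1 * (x / h\<^sup>2)) has_integral \<mu> 1 * (x / h\<^sup>2)) {0..1::real}"
    using has_integral_const_real[of "\<mu> 1 * (x / h\<^sup>2)" 0 1] by simp
  have "((\<lambda>\<eta>. \<mu> h * (x / (x + \<eta>)\<^sup>2) + \<mu> 1 * (x / h\<^sup>2)) has_integral
      \<mu> h * (1 - x / (x + 1)) + \<mu> 1 * (x / h\<^sup>2)) {0..1}"
    by (rule has_integral_add[OF has_integral_mult_right[OF pot_kern_integral[OF x]] c])
  moreover have "\<mu> \<eta> * (x / (x + \<eta>)\<^sup>2) \<le> \<mu> h * (x / (x + \<eta>)\<^sup>2) + \<mu> 1 * (x / h\<^sup>2)"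
    if "\<eta> \<in> {0..1}" for \<eta>
  proof (cases "\<eta> \<le> h")
    case True
    then have "\<mu> \<eta> * (x / (x + \<eta>)\<^sup>2) \<le> \<mu> h * (x / (x + \<eta>)\<^sup>2)"
      using x by (intro mult_right_mono mono_le) auto
    then show ?thesis using x by (simp add: add_increasing2)
  next
    case False
    have "x / (x + \<eta>)\<^sup>2 \<le> x / h\<^sup>2"
      using x h False by (intro divide_left_mono power_mono) auto
    then have "\<mu> \<eta> * (x / (x + \<eta>)\<^sup>2) \<le> \<mu> 1 * (x / h\<^sup>2)"
      using x that by (intro mult_mono mono_le) auto
    then show ?thesis using x by (simp add: add_increasing)
  qed
  ultimately have "pot x \<le> \<mu> h * (1 - x / (x + 1)) + \<mu> 1 * (x / h\<^sup>2)"
    unfolding pot_def by (intro has_integral_le[OF integrable_integral[OF pot_integrable[OF x]]])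
  also have "\<mu> h * (1 - x / (x + 1)) \<le> \<mu> h * 1"
    using x by (intro mult_left_mono) auto
  finally show ?thesis by simp
qed

lemma pot_tendsto_0: "(pot \<longlongrightarrow> 0) (at_right 0)"
\<comment> \<open>\<open>pot_le\<close> is used with \<open>h\<close> the fourth root of
  \<open>x\<close>: then \<open>h\<close> tends to 0, and so does
  \<open>x / h\<^sup>2 = sqrt x\<close>.\<close>
proof (rule tendsto_sandwich[of "\<lambda>_. 0" _ _ "\<lambda>x. \<mu> (sqrt (sqrt x)) + \<mu> 1 * sqrt x"])
  have "((\<lambda>x. sqrt (sqrt x)) \<longlongrightarrow> 0) (at_right 0)"
    by (auto intro!: tendsto_eq_intros)
  moreover have ev: "\<forall>\<^sub>F x in at_right 0. 0 < (x :: real)"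
    by (simp add: eventually_at_right_less)
  then have "\<forall>\<^sub>F x :: real in at_right 0. sqrt (sqrt x) \<in> {0<..} \<and> sqrt (sqrt x) \<noteq> 0"
    by eventually_elim auto
  ultimately have "filterlim (\<lambda>x. sqrt (sqrt x)) (at_right 0) (at_right 0)"
    by (simp add: filterlim_at)
  then have "((\<lambda>x. \<mu> (sqrt (sqrt x))) \<longlongrightarrow> 0) (at_right 0)"
    by (rule filterlim_compose[OF lim])
  then show "((\<lambda>x. \<mu> (sqrt (sqrt x)) + \<mu> 1 * sqrt x) \<longlongrightarrow> 0) (at_right 0)"
    by (auto intro!: tendsto_eq_intros)
  from ev show "\<forall>\<^sub>F x in at_right 0. pot x \<le> \<mu> (sqrt (sqrt x)) + \<mu> 1 * sqrt x"
  proof eventually_elim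
    case (elim x)
    then have "x / (sqrt (sqrt x))\<^sup>2 = sqrt x" by (simp add: real_div_sqrt)
    then show ?case using pot_le[OF elim, of "sqrt (sqrt x)"] elim by simp
  qed
  from ev show "\<forall>\<^sub>F x in at_right 0. 0 \<le> pot x"
    by eventually_elim (rule pot_nonneg)
qed simp

section \<open>Lower estimates for the potential and the moduli of continuity\<close>

lemma div_sq_integrable:
  assumes "0 < a" shows "(\<lambda>\<eta>. \<mu> \<eta> / \<eta>\<^sup>2) integrable_on {a..b}"
proof -
  have "(\<lambda>\<eta>. \<mu> \<eta> * (1 / \<eta>\<^sup>2)) integrable_on {a..b}"
  proof (rule integrable_mult)
    show "\<bar>1 / \<eta>\<^sup>2\<bar> \<le> 1 / a\<^sup>2" if "a \<le> \<eta>" for \<eta> :: real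
      using assms that by (auto intro!: divide_left_mono power_mono)
  qed measurable
  then show ?thesis by simp
qed

lemma div_sq_integral_bounds:
  assumes "0 < a" "a \<le> b"
  shows "\<mu> a * (1 / a - 1 / b) \<le> integral {a..b} (\<lambda>\<eta>. \<mu> \<eta> / \<eta>\<^sup>2)"
    and "integral {a..b} (\<lambda>\<eta>. \<mu> \<eta> / \<eta>\<^sup>2) \<le> \<mu> b * (1 / a - 1 / b)"
proof -
  have I: "((\<lambda>\<eta>. c * (1 / \<eta>\<^sup>2)) has_integral c * (1 / a - 1 / b)) {a..b}" for c
    by (intro has_integral_mult_right inverse_sq_integral assms)
  have i: "((\<lambda>\<eta>. \<mu> \<eta> / \<eta>\<^sup>2) has_integral integral {a..b} (\<lambda>\<eta>. \<mu> \<eta> / \<eta>\<^sup>2)) {a..b}"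
    by (intro integrable_integral div_sq_integrable assms)
  show "\<mu> a * (1 / a - 1 / b) \<le> integral {a..b} (\<lambda>\<eta>. \<mu> \<eta> / \<eta>\<^sup>2)"
    by (rule has_integral_le[OF I i]) (auto intro!: divide_right_mono mono_le)
  show "integral {a..b} (\<lambda>\<eta>. \<mu> \<eta> / \<eta>\<^sup>2) \<le> \<mu> b * (1 / a - 1 / b)"
    by (rule has_integral_le[OF i I]) (auto intro!: divide_right_mono mono_le)
qed

text \<open>The kernel of \<open>pot\<close> lives on [0, 1], so the part of the integral over
  [1, 4] is first absorbed into the one over [1/4, 1], which lies in [\<epsilon>, 1]. On
  [\<epsilon>, 1] the two integrands are comparable.\<close>

lemma pot_lower_bound:
  assumes \<epsilon>: "0 < \<epsilon>" "\<epsilon> \<le> 1/4"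
  shows "1 / (4 * (1 + 4 * \<sigma>)) * \<epsilon> * integral {\<epsilon>..4} (\<lambda>\<eta>. \<mu> \<eta> / \<eta>\<^sup>2) \<le> pot \<epsilon>"
proof -
  define I where "I a b = integral {a..b} (\<lambda>\<eta>. \<mu> \<eta> / \<eta>\<^sup>2)" for a b
  \<comment> \<open>The growth condition with factor 16 compares the upper bound on [1, 4] with the
    lower bound on [1/4, 1]; their ratio is \<open>4 * \<sigma>\<close>.\<close>
  have "I 1 4 \<le> \<mu> 4 * (3/4)"
    using div_sq_integral_bounds(2)[of 1 4] by (simp add: I_def)
  also have "\<mu> 4 \<le> 16 * \<sigma> * \<mu> (1/4)" using scale[of 16 "1/4"] by simp
  finally have "I 1 4 \<le> 4 * \<sigma> * (\<mu> (1/4) * 3)" by simp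
  also have "\<mu> (1/4) * 3 \<le> I (1/4) 1"
    using div_sq_integral_bounds(1)[of "1/4" 1] by (simp add: I_def)
  also have "I (1/4) 1 \<le> I \<epsilon> 1"
    unfolding I_def using \<epsilon> by (intro integral_subset_le div_sq_integrable) auto
  finally have "I 1 4 \<le> 4 * \<sigma> * I \<epsilon> 1" using sigma by (simp add: mult_left_mono)
  moreover have "I \<epsilon> 4 = I \<epsilon> 1 + I 1 4"
    unfolding I_def using \<epsilon> by (intro Henstock_Kurzweil_Integration.integral_combine[symmetric] div_sq_integrable) auto
  ultimately have "I \<epsilon> 4 \<le> (1 + 4 * \<sigma>) * I \<epsilon> 1" by (simp add: algebra_simps)
  then have "1 / (4 * (1 + 4 * \<sigma>)) * \<epsilon> * I \<epsilon> 4 \<le> 1 / (4 * (1 + 4 * \<sigma>)) * \<epsilon> * ((1 + 4 * \<sigma>) * I \<epsilon> 1)"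
    using \<epsilon> sigma by (intro mult_left_mono) auto
  also have "\<dots> = \<epsilon> / 4 * I \<epsilon> 1" using sigma by (simp add: divide_simps)
  also have "\<dots> = integral {\<epsilon>..1} (\<lambda>\<eta>. \<epsilon> / 4 * (\<mu> \<eta> / \<eta>\<^sup>2))"
    unfolding I_def by (rule integral_mult_right[symmetric])
  also have "\<dots> \<le> integral {\<epsilon>..1} (\<lambda>\<eta>. \<mu> \<eta> * (\<epsilon> / (\<epsilon> + \<eta>)\<^sup>2))"
  proof (rule integral_le)
    show "(\<lambda>\<eta>. \<epsilon> / 4 * (\<mu> \<eta> / \<eta>\<^sup>2)) integrable_on {\<epsilon>..1}"
      using \<epsilon> by (intro integrable_on_mult_right div_sq_integrable)
    show "(\<lambda>\<eta>. \<mu> \<eta> * (\<epsilon> / (\<epsilon> + \<eta>)\<^sup>2)) integrable_on {\<epsilon>..1}"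
      using \<epsilon> by (intro integrable_on_subinterval[OF pot_integrable]) auto
    fix \<eta> assume \<eta>: "\<eta> \<in> {\<epsilon>..1}"
    \<comment> \<open>Since \<open>\<epsilon> \<le> \<eta>\<close>, the sum
      \<open>\<epsilon> + \<eta>\<close> is at most \<open>2 * \<eta>\<close>; this costs the factor
      4 in the constant.\<close>
    have "\<epsilon> / (2 * \<eta>)\<^sup>2 \<le> \<epsilon> / (\<epsilon> + \<eta>)\<^sup>2"
      using \<epsilon> \<eta> by (intro divide_left_mono power_mono) auto
    then have "\<mu> \<eta> * (\<epsilon> / (2 * \<eta>)\<^sup>2) \<le> \<mu> \<eta> * (\<epsilon> / (\<epsilon> + \<eta>)\<^sup>2)"
      by (intro mult_left_mono) auto
    then show "\<epsilon> / 4 * (\<mu> \<eta> / \<eta>\<^sup>2) \<le> \<mu> \<eta> * (\<epsilon> / (\<epsilon> + \<eta>)\<^sup>2)"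
      by (simp add: mult_ac)
  qed
  also have "\<dots> \<le> pot \<epsilon>"
    unfolding pot_def using \<epsilon>
    by (intro integral_subset_le pot_integrable integrable_on_subinterval[OF pot_integrable]) auto
  finally show ?thesis by (simp add: I_def)
qed

text \<open>Comparing \<open>p \<epsilon>\<close> with \<open>p \<delta>\<close> and letting \<open>\<delta>\<close> tend to 0 makes it unnecessary to
  identify the boundary value of \<open>f\<close> at the origin.\<close>

lemma modulus_cont_ge_pot:
  fixes p :: "real \<Rightarrow> complex"
  assumes p: "\<And>x. 0 < x \<Longrightarrow> x < 1 \<Longrightarrow> p x \<in> D" "\<And>x y. cmod (p x - p y) = \<bar>x - y\<bar>"
    and f: "\<And>x. 0 < x \<Longrightarrow> x < 1 \<Longrightarrow> f (p x) = c + s * (pot x + pot (\<phi> x))" and s: "\<bar>s\<bar> = 1"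
    and \<phi>: "(\<phi> \<longlongrightarrow> 0) (at_right 0)" "\<And>x. 0 < x \<Longrightarrow> x < 1 \<Longrightarrow> 0 < \<phi> x"
    and \<epsilon>: "0 < \<epsilon>" "\<epsilon> < 1"
  shows "ereal (pot \<epsilon>) \<le> modulus_cont (closure D) (cont_ext D f) \<epsilon>"
proof (rule tendsto_upperbound)
  have ev: "\<forall>\<^sub>F \<delta> in at_right 0. \<delta> \<in> {0<..<\<epsilon>}"
    using \<epsilon> by (intro eventually_at_right_real)
  then have "\<forall>\<^sub>F \<delta> in at_right 0. \<phi> \<delta> \<in> {0<..} \<and> \<phi> \<delta> \<noteq> 0"
    by eventually_elim (use \<phi>(2) \<epsilon> in fastforce)
  then have "filterlim \<phi> (at_right 0) (at_right 0)"
    using \<phi>(1) by (simp add: filterlim_at)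
  then have "((\<lambda>\<delta>. pot (\<phi> \<delta>)) \<longlongrightarrow> 0) (at_right 0)"
    by (rule filterlim_compose[OF pot_tendsto_0])
  then show "((\<lambda>\<delta>. ereal (pot \<epsilon> - (pot \<delta> + pot (\<phi> \<delta>)))) \<longlongrightarrow> ereal (pot \<epsilon>)) (at_right 0)"
    using pot_tendsto_0 by (auto intro!: tendsto_eq_intros)
  from ev show "\<forall>\<^sub>F \<delta> in at_right 0. ereal (pot \<epsilon> - (pot \<delta> + pot (\<phi> \<delta>)))
      \<le> modulus_cont (closure D) (cont_ext D f) \<epsilon>"
  proof eventually_elim
    case (elim \<delta>)
    then have \<delta>: "0 < \<delta>" "\<delta> < \<epsilon>" "\<delta> < 1" using \<epsilon> by auto
    have "pot \<epsilon> - (pot \<delta> + pot (\<phi> \<delta>)) \<le> (pot \<epsilon> + pot (\<phi> \<epsilon>)) - (pot \<delta> + pot (\<phi> \<delta>))"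
      using pot_nonneg \<phi>(2) \<epsilon> by simp
    \<comment> \<open>The sign of \<open>s\<close> disappears under the absolute value, so one
      argument serves both sides of the circle.\<close>
    also have "\<dots> \<le> \<bar>s * ((pot \<epsilon> + pot (\<phi> \<epsilon>)) - (pot \<delta> + pot (\<phi> \<delta>)))\<bar>"
      unfolding abs_mult s by simp
    also have "\<dots> = norm (cont_ext D f (p \<epsilon>) - cont_ext D f (p \<delta>))"
      using \<delta> \<epsilon> by (simp add: cont_ext_def p f algebra_simps)
    finally have "ereal (pot \<epsilon> - (pot \<delta> + pot (\<phi> \<delta>)))
        \<le> ereal (norm (cont_ext D f (p \<epsilon>) - cont_ext D f (p \<delta>)))" by simp
    also have "\<dots> \<le> modulus_cont (closure D) (cont_ext D f) \<epsilon>"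
      unfolding modulus_cont_def using \<delta> \<epsilon> p closure_subset[of D]
      by (intro Sup_upper CollectI exI[of _ "p \<epsilon>"] exI[of _ "p \<delta>"]) auto
    finally show ?case .
  qed
qed simp

lemma modulus_inside:
  assumes "0 < \<epsilon>" "\<epsilon> < 1"
  shows "ereal (pot \<epsilon>) \<le> modulus_cont (closure D_plus) (cont_ext D_plus (\<lambda>z. Re (cauchy_type dens z))) \<epsilon>"
proof (rule modulus_cont_ge_pot[where p = "\<lambda>x. - of_real x" and s = "-1" and \<phi> = "\<lambda>x. x / (1 - x)"])
  show "- of_real x \<in> D_plus" if "0 < x" "x < 1" for x
  proof -
    have "cmod (-1 - (- of_real x)) = \<bar>-1 + x\<bar>" unfolding norm_of_real[symmetric, where 'a = complex] by simp
    then show ?thesis using that by (simp add: D_plus_eq dist_norm)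
  qed
  show "cmod (- of_real x - - of_real y) = \<bar>x - y\<bar>" for x y
    unfolding norm_of_real[symmetric, where 'a = complex] by (simp add: norm_minus_commute)
  show "Re (cauchy_type dens (- of_real x)) = - pot 1 + -1 * (pot x + pot (x / (1 - x)))"
    if "0 < x" "x < 1" for x
    using Re_cauchy_type_inside[OF that] by simp
  show "((\<lambda>x. x / (1 - x)) \<longlongrightarrow> 0) (at_right (0::real))"
    by (auto intro!: tendsto_eq_intros)
qed (use assms in auto)

lemma modulus_outside:
  assumes "0 < \<epsilon>" "\<epsilon> < 1"
  shows "ereal (pot \<epsilon>) \<le> modulus_cont (closure D_minus) (cont_ext D_minus (\<lambda>z. Re (cauchy_type dens z))) \<epsilon>"
proof (rule modulus_cont_ge_pot[where p = of_real and s = 1 and \<phi> = "\<lambda>x. x / (1 + x)"])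
  show "of_real x \<in> D_minus" if "0 < x" "x < 1" for x
  proof -
    have "cmod (-1 - of_real x) = \<bar>-1 - x\<bar>" unfolding norm_of_real[symmetric, where 'a = complex] by simp
    then show ?thesis using that by (simp add: D_minus_eq dist_norm)
  qed
  show "cmod (of_real x - of_real y) = \<bar>x - y\<bar>" for x y
    unfolding norm_of_real[symmetric, where 'a = complex] by simp
  show "Re (cauchy_type dens (of_real x)) =
      (integral {0..1} (\<lambda>y. dens (circ y)) + pot 1) + 1 * (pot x + pot (x / (1 + x)))"
    if "0 < x" "x < 1" for x
    using Re_cauchy_type_outside[OF that(1)] by simp
  show "((\<lambda>x. x / (1 + x)) \<longlongrightarrow> 0) (at_right (0::real))"
    by (auto intro!: tendsto_eq_intros)
qed (use assms in auto)

end

section \<open>Extension of the given majorant by zero and conclusion\<close>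

lemma majorant_cut:
  assumes m: "normal_majorant \<sigma> 1 \<mu>" and lim: "(\<mu> \<longlongrightarrow> 0) (at_right 0)"
  shows "majorant \<sigma> (\<lambda>x. if 0 < x then \<mu> x else 0)"
proof
  have mono: "\<mu> x \<le> \<mu> y" if "0 < x" "x \<le> y" for x y
    using m that by (auto simp: normal_majorant_def mono_on_def)
  \<comment> \<open>A non-decreasing function with right limit 0 at the origin cannot be negative to
    the right of it.\<close>
  have nonneg: "0 \<le> \<mu> y" if "0 < y" for y
  proof (rule tendsto_upperbound[OF lim])
    show "\<forall>\<^sub>F x in at_right 0. \<mu> x \<le> \<mu> y"
      using eventually_at_right_real[OF that] by eventually_elim (auto intro: mono)
  qed simp
  show "mono (\<lambda>x. if 0 < x then \<mu> x else 0)"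
    by (rule monoI) (auto intro: mono nonneg)
  have "\<forall>\<^sub>F x in at_right 0. \<mu> x = (if 0 < x then \<mu> x else 0)"
    using eventually_at_right_less[of "0::real"] by eventually_elim simp
  then show "((\<lambda>x. if 0 < x then \<mu> x else 0) \<longlongrightarrow> 0) (at_right 0)"
    by (rule Lim_transform_eventually[OF lim])
qed (use m in \<open>auto simp: normal_majorant_def\<close>)

theorem theorem3:
  fixes \<sigma> :: real and \<mu> :: "real \<Rightarrow> real" and g :: "complex \<Rightarrow> real"
  assumes "\<sigma> \<ge> 1"
    and "normal_majorant \<sigma> 1 \<mu>"
    and "(\<mu> \<longlongrightarrow> 0) (at_right 0)"
    and "\<mu> 0 = 0"
    and "\<And>t. t \<in> gam \<Longrightarrow>
      g t = 8 * integral {0..1} (\<lambda>\<eta>.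
              \<mu> \<eta> * ((((Re t)\<^sup>2 - (Im t)\<^sup>2) * (\<eta> ^ 4 + cmod t ^ 4) - 2 * \<eta>\<^sup>2 * cmod t ^ 4)
                      / cmod ((complex_of_real \<eta>)\<^sup>2 - t\<^sup>2) ^ 4) * \<eta>)"
  shows "continuous_on gam g \<and>
    (\<exists>C::real. \<forall>\<epsilon>\<ge>0. modulus_cont gam g \<epsilon> \<le> ereal (C * \<mu> \<epsilon>)) \<and>
    (\<exists>c>0. \<forall>\<epsilon>. 0 < \<epsilon> \<and> \<epsilon> \<le> 1/4 \<longrightarrow>
       modulus_cont (closure D_plus) (cont_ext D_plus (\<lambda>z. Re (cauchy_type g z))) \<epsilon>
         \<ge> ereal (c * \<epsilon> * integral {\<epsilon>..4} (\<lambda>\<eta>. \<mu> \<eta> / \<eta>\<^sup>2)) \<and>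
       modulus_cont (closure D_minus) (cont_ext D_minus (\<lambda>z. Re (cauchy_type g z))) \<epsilon>
         \<ge> ereal (c * \<epsilon> * integral {\<epsilon>..4} (\<lambda>\<eta>. \<mu> \<eta> / \<eta>\<^sup>2)))"
proof -
  define M where "M x = (if 0 < x then \<mu> x else 0)" for x
  interpret majorant \<sigma> M
    unfolding M_def using assms(2,3) by (rule majorant_cut)
  \<comment> \<open>Agreement at 0 as well is what transfers the bound for \<epsilon> = 0 and the
    integrands on [0, 1].\<close>
  have M: "M x = \<mu> x" if "0 \<le> x" for x
    using that assms(4) by (cases "x = 0") (auto simp: M_def)
  have g: "g t = dens t" if "t \<in> gam" for t
    unfolding assms(5)[OF that] dens_def integral_mult_right[symmetric]
  proof (rule integral_cong)
    fix \<eta> :: real assume "\<eta> \<in> {0..1}"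
    then show "8 * (\<mu> \<eta> * ((((Re t)\<^sup>2 - (Im t)\<^sup>2) * (\<eta> ^ 4 + cmod t ^ 4) - 2 * \<eta>\<^sup>2 * cmod t ^ 4)
        / cmod ((complex_of_real \<eta>)\<^sup>2 - t\<^sup>2) ^ 4) * \<eta>) = M \<eta> * kern \<eta> t"
      unfolding kern_explicit[symmetric] by (simp add: M)
  qed
  have cauchy: "cauchy_type g = cauchy_type dens"
    unfolding cauchy_type_def
    by (intro ext arg_cong2[where f = "(*)"] refl contour_integral_eq) (simp add: g gam_eq_path_image)
  have "modulus_cont gam g = modulus_cont gam dens"
    unfolding modulus_cont_def by (intro ext arg_cong[where f = Sup] Collect_cong ex_cong1) (auto simp: g)
  then have "\<forall>\<epsilon>\<ge>0. modulus_cont gam g \<epsilon> \<le> ereal (1800 * \<sigma>\<^sup>2 * \<mu> \<epsilon>)"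
    using modulus_dens M by simp
  moreover have "continuous_on gam g"
    using continuous_on_dens g by (simp cong: continuous_on_cong)
  moreover have "ereal (1 / (4 * (1 + 4 * \<sigma>)) * \<epsilon> * integral {\<epsilon>..4} (\<lambda>\<eta>. \<mu> \<eta> / \<eta>\<^sup>2)) \<le> ereal (pot \<epsilon>)"
    if "0 < \<epsilon>" "\<epsilon> \<le> 1/4" for \<epsilon>
  proof -
    have "integral {\<epsilon>..4} (\<lambda>\<eta>. \<mu> \<eta> / \<eta>\<^sup>2) = integral {\<epsilon>..4} (\<lambda>\<eta>. M \<eta> / \<eta>\<^sup>2)"
      using that by (intro integral_cong) (simp add: M)
    then show ?thesis using pot_lower_bound[OF that] by simp
  qed
  then have "\<forall>\<epsilon>. 0 < \<epsilon> \<and> \<epsilon> \<le> 1/4 \<longrightarrow>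
       modulus_cont (closure D_plus) (cont_ext D_plus (\<lambda>z. Re (cauchy_type g z))) \<epsilon>
         \<ge> ereal (1 / (4 * (1 + 4 * \<sigma>)) * \<epsilon> * integral {\<epsilon>..4} (\<lambda>\<eta>. \<mu> \<eta> / \<eta>\<^sup>2)) \<and>
       modulus_cont (closure D_minus) (cont_ext D_minus (\<lambda>z. Re (cauchy_type g z))) \<epsilon>
         \<ge> ereal (1 / (4 * (1 + 4 * \<sigma>)) * \<epsilon> * integral {\<epsilon>..4} (\<lambda>\<eta>. \<mu> \<eta> / \<eta>\<^sup>2))"
    unfolding cauchy
    by (auto intro!: order.trans[OF _ modulus_inside] order.trans[OF _ modulus_outside])
  moreover have "0 < 1 / (4 * (1 + 4 * \<sigma>))" using assms(1) by simp
  ultimately show ?thesis by blast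
qed

end
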